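(* Let $\Omega$ be a bounded Lipschitz domain in $\mathbb R^N$, and let $g:\Omega\times\mathbb R_+\to\mathbb R_+$ be continuous with $g(x,0)=0$ and $g(x,\cdot)$ nondecreasing for all $x\in\Omega$, and such that for some real $C_1\ge1$, $g(x',a)\le C_1g(x,a)$ for all $a\ge0$ whenever $x,x'\in\Omega$, $|x'-x|\le\frac12\delta(x)$. Suppose that for some constants $C_2\ge1$ and $\varepsilon_0>0$: (KOT)$'$ $\displaystyle\int_{2a}^\infty\frac{dt}{\sqrt{G(x,t)}}\le C_2\sqrt{\frac{a}{g(x,a)}}$ whenever $a>0$, $x\in\Omega$ and $g(x,a)\ge C_2\,a$, where $G(x,t)=\int_0^tg(x,s)\,ds$; (QI) $g$ is $(C_2,\varepsilon_0)$-quasi inwardly increasing (near the boundary) in $\Omega$. Then there is a real $\bar c\ge1$ depending only on $\Omega$ and $g$ such that for every closed subset $F$ of $\partial\Omega$ and every nonnegative solution $u$ of $-\Delta u(x)+g(x,u(x))=0$ in $\Omega$ that vanishes on $\partial\Omega\setminus F$, $$g(x,u(x))\le\frac{\bar c}{d(x,F)^2}\,u(x),\qquad x\in\Omega.$$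
   Context: $\delta(x)=\mathrm{dist}(x,\mathbb R^N\setminus\Omega)$, $\mathbb R_+=[0,\infty)$, $d(x,F)$ is the distance from $x$ to $F$, and $\Omega(\varepsilon)=\{x\in\Omega:\delta(x)<\varepsilon\}$ for $\varepsilon>0$. A nonnegative function $u$ in $\Omega$ is a solution if $u$ and $g(\cdot,u(\cdot))$ are in $L^1_{loc}(\Omega)$ and $\Delta u=g(\cdot,u(\cdot))$ in the sense of distributions (such $u$ is taken to be continuous). "Vanishes on $\partial\Omega\setminus F$" means $u$ tends to $0$ at each point of $\partial\Omega\setminus F$. For $C\ge1$, $\varepsilon_0>0$, $g$ is $(C,\varepsilon_0)$-quasi inwardly increasing (near the boundary) in $\Omega$ if whenever $x\in\Omega(\varepsilon_0)$, $0<r<\varepsilon_0$ and $a>0$, one has $g(x,a)\le C\,g(x',Ca)$ for at least one point $x'\in\{z\in\mathbb R^N:|z-x|=r,\ \delta(z)\ge\varepsilon_0r\}$. *)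

theory Defs
  imports "HOL-Analysis.Analysis"
begin

definition bdist :: "'a::euclidean_space set \<Rightarrow> 'a \<Rightarrow> real"
  where "bdist \<Omega> x = infdist x (- \<Omega>)"

text \<open>Near each boundary point the domain is the strict epigraph, in the direction of a unit vector
  \<open>e\<close>, of a Lipschitz function \<open>\<psi>\<close> on the hyperplane orthogonal to \<open>e\<close>;
  \<open>x - (x \<bullet> e) *\<^sub>R e\<close> is the projection of \<open>x\<close> to that hyperplane.\<close>

definition bounded_lipschitz_domain :: "'a::euclidean_space set \<Rightarrow> bool"
  where "bounded_lipschitz_domain \<Omega> \<longleftrightarrow>
    open \<Omega> \<and> connected \<Omega> \<and> \<Omega> \<noteq> {} \<and> bounded \<Omega> \<and>
    (\<forall>p\<in>frontier \<Omega>. \<exists>U e \<psi> L.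
        open U \<and> p \<in> U \<and> norm e = 1 \<and> L-lipschitz_on {y. y \<bullet> e = 0} (\<psi> :: 'a \<Rightarrow> real) \<and>
        (\<forall>x\<in>U. x \<in> \<Omega> \<longleftrightarrow> \<psi> (x - (x \<bullet> e) *\<^sub>R e) < x \<bullet> e))"

definition partial :: "'a::euclidean_space \<Rightarrow> ('a \<Rightarrow> real) \<Rightarrow> 'a \<Rightarrow> real"
  where "partial b f x = frechet_derivative f (at x) b"

definition laplacian :: "('a::euclidean_space \<Rightarrow> real) \<Rightarrow> 'a \<Rightarrow> real"
  where "laplacian f x = (\<Sum>b\<in>Basis. partial b (partial b f) x)"

primrec C_k :: "nat \<Rightarrow> ('a::euclidean_space \<Rightarrow> real) \<Rightarrow> bool"
  where
    "C_k 0 f \<longleftrightarrow> continuous_on UNIV f"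
  | "C_k (Suc k) f \<longleftrightarrow> (\<forall>x. f differentiable (at x)) \<and> (\<forall>b\<in>Basis. C_k k (partial b f))"

definition test_function :: "'a::euclidean_space set \<Rightarrow> ('a \<Rightarrow> real) \<Rightarrow> bool"
  where "test_function \<Omega> \<phi> \<longleftrightarrow>
    (\<forall>k. C_k k \<phi>) \<and> compact (closure {x. \<phi> x \<noteq> 0}) \<and> closure {x. \<phi> x \<noteq> 0} \<subseteq> \<Omega>"

definition L1_loc :: "'a::euclidean_space set \<Rightarrow> ('a \<Rightarrow> real) \<Rightarrow> bool"
  where "L1_loc \<Omega> f \<longleftrightarrow> (\<forall>K. compact K \<and> K \<subseteq> \<Omega> \<longrightarrow> set_integrable lborel K f)"

text \<open>Nonlinearities are total functions \<open>g\<close>, of which only the values on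
  \<open>\<Omega> \<times> {0..}\<close> matter; likewise only the values of \<open>u\<close> on \<open>\<Omega>\<close> matter below.\<close>

definition nonneg_solution ::
    "'a::euclidean_space set \<Rightarrow> ('a \<Rightarrow> real \<Rightarrow> real) \<Rightarrow> ('a \<Rightarrow> real) \<Rightarrow> bool"
  where "nonneg_solution \<Omega> g u \<longleftrightarrow>
    (\<forall>x\<in>\<Omega>. 0 \<le> u x) \<and> continuous_on \<Omega> u \<and> L1_loc \<Omega> u \<and> L1_loc \<Omega> (\<lambda>x. g x (u x)) \<and>
    (\<forall>\<phi>. test_function \<Omega> \<phi> \<longrightarrow>
        (LINT x:\<Omega>|lborel. u x * laplacian \<phi> x) = (LINT x:\<Omega>|lborel. g x (u x) * \<phi> x))"

definition vanishes_on :: "'a::euclidean_space set \<Rightarrow> 'a set \<Rightarrow> ('a \<Rightarrow> real) \<Rightarrow> bool"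
  where "vanishes_on \<Omega> A u \<longleftrightarrow> (\<forall>y\<in>A. (u \<longlongrightarrow> 0) (at y within \<Omega>))"

definition primitive :: "('a \<Rightarrow> real \<Rightarrow> real) \<Rightarrow> 'a \<Rightarrow> real \<Rightarrow> real"
  where "primitive g x t = integral {0..t} (g x)"

text \<open>The integral is taken in \<open>[0,\<infinity>]\<close>, so the bound includes its convergence.
  The condition \<open>g x a \<ge> C * a\<close> makes \<open>primitive g x\<close> positive on \<open>{2*a..}\<close>
  for nondecreasing nonnegative \<open>g x\<close>.\<close>

definition KOT' :: "'a::euclidean_space set \<Rightarrow> ('a \<Rightarrow> real \<Rightarrow> real) \<Rightarrow> real \<Rightarrow> bool"
  where "KOT' \<Omega> g C \<longleftrightarrow>
    (\<forall>x\<in>\<Omega>. \<forall>a>0. g x a \<ge> C * a \<longrightarrow>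
        (\<integral>\<^sup>+t\<in>{2*a..}. ennreal (1 / sqrt (primitive g x t)) \<partial>lborel) \<le> ennreal (C * sqrt (a / g x a)))"

text \<open>Since \<open>bdist \<Omega>\<close> vanishes off \<open>\<Omega>\<close>, the points \<open>x'\<close> below lie in \<open>\<Omega>\<close>.\<close>

definition quasi_inwardly_increasing ::
    "real \<Rightarrow> real \<Rightarrow> 'a::euclidean_space set \<Rightarrow> ('a \<Rightarrow> real \<Rightarrow> real) \<Rightarrow> bool"
  where "quasi_inwardly_increasing C \<epsilon> \<Omega> g \<longleftrightarrow>
    (\<forall>x\<in>\<Omega>. \<forall>r a. bdist \<Omega> x < \<epsilon> \<and> 0 < r \<and> r < \<epsilon> \<and> 0 < a \<longrightarrow>
        (\<exists>x'. dist x' x = r \<and> bdist \<Omega> x' \<ge> \<epsilon> * r \<and> g x a \<le> C * g x' (C * a)))"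

text \<open>Estimates with the factor \<open>c / (infdist x F)\<^sup>2\<close> remain meaningful for \<open>F = {}\<close>:
  there \<open>infdist x F = 0\<close> and the quotient is \<open>0\<close>, which agrees with the usual reading
  \<open>d(x, {}) = \<infinity>\<close>. For closed nonempty \<open>F \<subseteq> frontier \<Omega>\<close> and \<open>x\<close> in the open set
  \<open>\<Omega>\<close> the distance is positive.\<close>

end

theory Submission
  imports Defs
begin

text \<open>Write \<open>\<delta>\<close> for the distance to the complement of \<open>\<Omega>\<close>, fix a solution \<open>u\<close> and a point \<open>x\<close>, and put
  \<open>a = u x\<close>, \<open>d = infdist x F\<close>.

  The integral condition serves to show that \<open>g x t / t\<close> grows at least like a power of \<open>t\<close>
  beyond any \<open>a\<close> at which \<open>g x a / a\<close> is large (\<open>KO_growth\<close>). The other analytic tool is a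
  maximum principle for continuous distributional solutions (\<open>no_local_max\<close>), obtained by
  mollification. Comparing \<open>u\<close> with a paraboloid shows that \<open>u\<close> must rise by a definite amount on
  small balls around a point where \<open>g\<close> is large (\<open>quadratic_growth\<close>). A point that maximises
  \<open>u y * (R - dist y x) ^ p\<close> in the ball of radius \<open>R = \<delta> x / 4\<close> is one around which \<open>u\<close> rises by
  at most a bounded factor, and together with the growth of \<open>g\<close> this gives the interior estimate
  \<open>g x (u x) \<le> c0 * u x / (\<delta> x)\<^sup>2\<close> (\<open>interior_estimate\<close>). It is the asserted bound whenever
  \<open>\<delta> x\<close> is comparable to \<open>d\<close>.

  Let then \<open>\<delta> x\<close> be small compared with \<open>d\<close>, and suppose that \<open>g x a\<close> exceeds a large multiple of
  \<open>a / d\<^sup>2\<close>. Quasi inward monotonicity carries this to a point \<open>x'\<close> at a distance \<open>r\<close> proportional to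
  \<open>d\<close> and at a depth comparable to \<open>d\<close>: \<open>g x' A\<close> exceeds a large multiple of \<open>A / d\<^sup>2\<close> for
  \<open>A = C2 * a\<close>. The local comparability of \<open>g\<close>, iterated along vertical segments in a Lipschitz
  chart (\<open>boundary_chain\<close>), compares \<open>g y\<close> with \<open>g x'\<close> for every \<open>y\<close> near \<open>x\<close> up to a power of
  \<open>d / \<delta> y\<close>. The growth of \<open>g\<close> and the interior estimate at \<open>y\<close> then leave only
  \<open>u y \<le> A * (d / \<delta> y) ^ \<gamma>\<close> (\<open>polynomial_bound\<close>). A subharmonic function that vanishes on a
  portion of a Lipschitz boundary is small near it compared with its maximum (\<open>boundary_decay\<close>,
  from a barrier around an exterior ball), and a weighted maximum turns the polynomial bound into
  \<open>u \<le> L * A\<close> on a half ball (\<open>carleson_estimate\<close>). One more application of the decay at \<open>x\<close>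
  itself gives \<open>u x \<le> a / 2\<close>, a contradiction. The case \<open>F = {}\<close> is the maximum principle.\<close>

section \<open>Smooth bump functions\<close>


lemma C_k_Suc_imp: "C_k (Suc k) f \<Longrightarrow> C_k k f"
proof (induction k arbitrary: f)
  case 0
  then show ?case
    by (auto intro!: continuous_at_imp_continuous_on differentiable_imp_continuous_within)
next
  case (Suc k)
  then show ?case by (metis C_k.simps(2))
qed

lemma partial_eq: "(f has_derivative f') (at x) \<Longrightarrow> partial b f x = f' b"
  unfolding partial_def using frechet_derivative_at by metis

lemma C_k_const: "C_k k (\<lambda>x. c)"
proof (induction k arbitrary: c)
  case (Suc k)
  have "partial b (\<lambda>x::'a. c) = (\<lambda>x. 0)" for b
    by (rule ext) (auto intro!: partial_eq[of _ "\<lambda>x. 0", simplified] derivative_eq_intros)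
  then show ?case using Suc by auto
qed auto

lemma C_k_add: "C_k k f \<Longrightarrow> C_k k h \<Longrightarrow> C_k k (\<lambda>x. f x + h x)"
proof (induction k arbitrary: f h)
  case (Suc k)
  have "partial b (\<lambda>x. f x + h x) = (\<lambda>x. partial b f x + partial b h x)" for b
    using Suc.prems
    by (intro ext partial_eq) (auto simp: partial_def intro!: has_derivative_add
        simp flip: frechet_derivative_works)
  then show ?case using Suc by auto
qed (auto intro!: continuous_intros)

text \<open>The product rule refers to the factors as well as to their partial derivatives, which is why the
  induction needs \<open>C_k_Suc_imp\<close>.\<close>

lemma C_k_mult: "C_k k f \<Longrightarrow> C_k k h \<Longrightarrow> C_k k (\<lambda>x. f x * h x)"
proof (induction k arbitrary: f h)
  case (Suc k)
  have "partial b (\<lambda>x. f x * h x) = (\<lambda>x. f x * partial b h x + partial b f x * h x)" for b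
  proof (rule ext, rule partial_eq)
    fix x
    have "(f has_derivative frechet_derivative f (at x)) (at x)"
      "(h has_derivative frechet_derivative h (at x)) (at x)"
      using Suc.prems by (auto simp flip: frechet_derivative_works)
    from has_derivative_mult[OF this]
    show "((\<lambda>x. f x * h x) has_derivative (\<lambda>b. f x * partial b h x + partial b f x * h x)) (at x)"
      by (simp add: partial_def)
  qed
  then show ?case using Suc C_k_Suc_imp[OF Suc.prems(1)] C_k_Suc_imp[OF Suc.prems(2)]
    by (auto intro!: C_k_add)
qed (auto intro!: continuous_intros)

lemma C_k_inner: "C_k k (\<lambda>x. (x - y) \<bullet> v)"
proof (cases k)
  case (Suc k')
  have "partial b (\<lambda>x. (x - y) \<bullet> v) = (\<lambda>x. b \<bullet> v)" for b
    by (intro ext partial_eq) (auto intro!: derivative_eq_intros)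
  then show ?thesis using Suc C_k_const by auto
qed (auto intro!: continuous_intros)

text \<open>The factors \<open>1 / s ^ m\<close> make the family closed under differentiation: \<open>flat_exp 0\<close> is the classical
  flat function \<open>exp (- 1 / s)\<close>, and its derivatives are combinations of the other members.\<close>

definition flat_exp :: "nat \<Rightarrow> real \<Rightarrow> real"
  where "flat_exp m s = (if s > 0 then exp (- inverse s) * inverse s ^ m else 0)"

lemma flat_exp_tendsto_0: "((\<lambda>s. inverse s * flat_exp m s) \<longlongrightarrow> 0) (at 0)"
proof (rule filterlim_split_at)
  show "((\<lambda>s. inverse s * flat_exp m s) \<longlongrightarrow> 0) (at_left 0)"
    by (rule tendsto_eventually) (auto simp: flat_exp_def eventually_at_filter)
  have "((\<lambda>s. s ^ Suc m / exp s) \<longlongrightarrow> (0::real)) at_top"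
    by (rule tendsto_power_div_exp_0)
  from filterlim_compose[OF this filterlim_inverse_at_top_right]
  have "((\<lambda>s. inverse s ^ Suc m / exp (inverse s)) \<longlongrightarrow> (0::real)) (at_right 0)" .
  moreover have "\<forall>\<^sub>F s in at_right 0. inverse s ^ Suc m / exp (inverse s) = inverse s * flat_exp m s"
    by (auto simp: flat_exp_def eventually_at_filter exp_minus field_simps)
  ultimately show "((\<lambda>s. inverse s * flat_exp m s) \<longlongrightarrow> 0) (at_right 0)"
    by (rule Lim_transform_eventually)
qed

lemma flat_exp_deriv:
  "(flat_exp m has_real_derivative (flat_exp (m + 2) s - real m * flat_exp (m + 1) s)) (at s)"
proof -
  consider "s > 0" | "s < 0" | "s = 0" by linarith
  then show ?thesis
  proof cases
    case 1
    have "((\<lambda>s. exp (- inverse s) * inverse s ^ m) has_real_derivative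
        (flat_exp (m + 2) s - real m * flat_exp (m + 1) s)) (at s)"
      using 1 by (auto intro!: derivative_eq_intros simp: flat_exp_def algebra_simps power2_eq_square)
         (cases m; simp add: field_simps)
    then show ?thesis
      by (rule has_field_derivative_transform_within_open[of _ _ _ "{0<..}"])
        (use 1 in \<open>auto simp: flat_exp_def\<close>)
  next
    case 2
    have "((\<lambda>s. 0) has_real_derivative 0) (at s)" by simp
    then have "(flat_exp m has_real_derivative 0) (at s)"
      by (rule has_field_derivative_transform_within_open[of _ _ _ "{..<0}"])
        (use 2 in \<open>auto simp: flat_exp_def\<close>)
    then show ?thesis using 2 by (simp add: flat_exp_def)
  next
    case 3
    have "(flat_exp m has_real_derivative 0) (at 0)"
      unfolding has_field_derivative_iff
      using flat_exp_tendsto_0[of m] by (simp add: flat_exp_def[of m 0] divide_inverse mult.commute)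
    then show ?thesis using 3 by (simp add: flat_exp_def)
  qed
qed

lemma flat_exp_nonneg: "0 \<le> flat_exp m s" by (simp add: flat_exp_def)

lemma flat_exp_cont: "continuous_on S (flat_exp m)"
  by (meson DERIV_isCont continuous_at_imp_continuous_on flat_exp_deriv)

definition bump :: "nat \<Rightarrow> real \<Rightarrow> 'a::euclidean_space \<Rightarrow> real"
  where "bump m \<epsilon> v = flat_exp m (\<epsilon>\<^sup>2 - v \<bullet> v)"

lemma bump_has_derivative:
  "((\<lambda>x. bump m \<epsilon> (x - y)) has_derivative
     (\<lambda>b. (bump (m + 2) \<epsilon> (x - y) - real m * bump (m + 1) \<epsilon> (x - y)) * (-2 * ((x - y) \<bullet> b)))) (at x)"
proof -
  have q: "((\<lambda>x. \<epsilon>\<^sup>2 - (x - y) \<bullet> (x - y)) has_derivative (\<lambda>b. -2 * ((x - y) \<bullet> b))) (at x)"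
    by (auto intro!: derivative_eq_intros simp: inner_commute)
  show ?thesis unfolding bump_def
    using has_derivative_compose[OF q flat_exp_deriv[unfolded has_field_derivative_def]]
    by simp
qed

text \<open>The derivative of each bump is a product of bumps of higher order with a polynomial, so that one
  induction on \<open>k\<close>, for all orders \<open>m\<close> at once, suffices.\<close>

lemma bump_C_k: "C_k k (\<lambda>x. bump m \<epsilon> (x - y))"
proof (induction k arbitrary: m)
  case 0
  show ?case
    unfolding C_k.simps
    by (intro continuous_at_imp_continuous_on ballI has_derivative_continuous[OF bump_has_derivative])
next
  case (Suc k)
  have "partial b (\<lambda>x. bump m \<epsilon> (x - y)) =
    (\<lambda>x. (bump (m + 2) \<epsilon> (x - y) + (- real m) * bump (m + 1) \<epsilon> (x - y)) * ((-2) * ((x - y) \<bullet> b)))" for b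
    by (rule ext) (simp add: partial_eq[OF bump_has_derivative])
  moreover have "(\<lambda>x. bump m \<epsilon> (x - y)) differentiable (at x)" for x
    using bump_has_derivative differentiableI by blast
  ultimately show ?case
    unfolding C_k.simps
    by (simp only:) (intro conjI allI ballI TrueI C_k_mult C_k_add C_k_const C_k_inner Suc)
qed

lemma bump_zero: "0 \<le> \<epsilon> \<Longrightarrow> \<epsilon> \<le> norm v \<Longrightarrow> bump m \<epsilon> v = 0"
  using power_mono[of \<epsilon> "norm v" 2] by (simp add: bump_def flat_exp_def power2_norm_eq_inner)

lemma bump_test_function:
  assumes "0 \<le> \<epsilon>" "cball y \<epsilon> \<subseteq> \<Omega>"
  shows "test_function \<Omega> (\<lambda>x. bump 0 \<epsilon> (x - y))"
proof -
  have "{x. bump 0 \<epsilon> (x - y) \<noteq> 0} \<subseteq> cball y \<epsilon>"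
    using bump_zero[OF assms(1)] by (force simp: dist_norm norm_minus_commute)
  then have "closure {x. bump 0 \<epsilon> (x - y) \<noteq> 0} \<subseteq> cball y \<epsilon>"
    by (rule closure_minimal) auto
  then show ?thesis
    using assms(2) bounded_subset[OF bounded_cball] unfolding test_function_def
    by (auto simp: compact_eq_bounded_closed bump_C_k)
qed

definition bump_partial :: "real \<Rightarrow> 'a::euclidean_space \<Rightarrow> 'a \<Rightarrow> real"
  where "bump_partial \<epsilon> b v = -2 * bump 2 \<epsilon> v * (v \<bullet> b)"

definition bump_partial2 :: "real \<Rightarrow> 'a::euclidean_space \<Rightarrow> 'a \<Rightarrow> real"
  where "bump_partial2 \<epsilon> b v = 4 * (bump 4 \<epsilon> v - 2 * bump 3 \<epsilon> v) * (v \<bullet> b)\<^sup>2 - 2 * bump 2 \<epsilon> v * (b \<bullet> b)"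

lemma bump_has_partial: "((\<lambda>x. bump 0 \<epsilon> (x - y)) has_derivative (\<lambda>b. bump_partial \<epsilon> b (x - y))) (at x)"
  using bump_has_derivative[of 0 \<epsilon> y x] by (simp add: bump_partial_def mult_ac numeral_2_eq_2)

lemma bump_partial_has_partial:
  "((\<lambda>x. bump_partial \<epsilon> b (x - y)) has_derivative
     (\<lambda>c. 4 * (bump 4 \<epsilon> (x - y) - 2 * bump 3 \<epsilon> (x - y)) * ((x - y) \<bullet> b) * ((x - y) \<bullet> c)
        - 2 * bump 2 \<epsilon> (x - y) * (c \<bullet> b))) (at x)"
proof -
  have B: "((\<lambda>x. bump 2 \<epsilon> (x - y)) has_derivative
     (\<lambda>b. (bump 4 \<epsilon> (x - y) - 2 * bump 3 \<epsilon> (x - y)) * (-2 * ((x - y) \<bullet> b)))) (at x)"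
    using bump_has_derivative[of 2 \<epsilon> y x] by (simp add: eval_nat_numeral)
  show ?thesis unfolding bump_partial_def
    by (rule derivative_eq_intros B refl | simp)+ (auto simp: fun_eq_iff algebra_simps)
qed

lemma bump_laplacian: "laplacian (\<lambda>x. bump 0 \<epsilon> (x - y)) x = (\<Sum>b\<in>Basis. bump_partial2 \<epsilon> b (x - y))"
proof -
  have "partial b (\<lambda>x. bump 0 \<epsilon> (x - y)) = (\<lambda>x. bump_partial \<epsilon> b (x - y))" for b
    by (rule ext) (rule partial_eq[OF bump_has_partial])
  then show ?thesis
    unfolding laplacian_def
    by (auto intro!: sum.cong simp: partial_eq[OF bump_partial_has_partial] bump_partial2_def power2_eq_square inner_commute)
qed

section \<open>Mollification and the maximum principle\<close>


lemma bump_line_deriv1: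
  "((\<lambda>t. bump 0 \<epsilon> (x - (y + t *\<^sub>R b))) has_real_derivative - bump_partial \<epsilon> b (x - (y + t *\<^sub>R b))) (at t)"
proof -
  have l: "((\<lambda>t. x - (y + t *\<^sub>R b)) has_derivative (\<lambda>s. - (s *\<^sub>R b))) (at t)"
    by (auto intro!: derivative_eq_intros)
  show ?thesis
    using has_derivative_compose[OF l bump_has_partial[of \<epsilon> 0, simplified]]
    unfolding has_field_derivative_def
    by (rule back_subst[of "\<lambda>h. (_ has_derivative h) _"]) (auto simp: bump_partial_def fun_eq_iff)
qed

lemma bump_line_deriv2:
  "((\<lambda>t. - bump_partial \<epsilon> b (x - (y + t *\<^sub>R b))) has_real_derivative bump_partial2 \<epsilon> b (x - (y + t *\<^sub>R b))) (at t)"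
proof -
  have l: "((\<lambda>t. x - (y + t *\<^sub>R b)) has_derivative (\<lambda>s. - (s *\<^sub>R b))) (at t)"
    by (auto intro!: derivative_eq_intros)
  show ?thesis
    using has_derivative_minus[OF has_derivative_compose[OF l bump_partial_has_partial[of \<epsilon> b 0, simplified]]]
    unfolding has_field_derivative_def
    by (rule back_subst[of "\<lambda>h. (_ has_derivative h) _"])
      (auto simp add: bump_partial2_def fun_eq_iff algebra_simps power2_eq_square)
qed

lemma bump_continuous [continuous_intros]:
  "continuous_on S h \<Longrightarrow> continuous_on S (\<lambda>x. bump m \<epsilon> (h x))"
  unfolding bump_def by (intro continuous_on_compose2[OF flat_exp_cont[of UNIV]] continuous_intros) auto

lemma bump_partial_continuous [continuous_intros]:
  "continuous_on S h \<Longrightarrow> continuous_on S (\<lambda>x. bump_partial \<epsilon> b (h x))"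
  unfolding bump_partial_def by (intro continuous_intros)

lemma bump_partial2_continuous [continuous_intros]:
  "continuous_on S h \<Longrightarrow> continuous_on S (\<lambda>x. bump_partial2 \<epsilon> b (h x))"
  unfolding bump_partial2_def by (intro continuous_intros)

text \<open>Differentiation under the integral along the line through \<open>y\<close> in direction \<open>b\<close>. It serves for the
  bump with its first and then for the first with the second partial derivative.\<close>

lemma mollified_line_deriv:
  fixes u :: "'a::euclidean_space \<Rightarrow> real"
  assumes u: "continuous_on (cbox c d) u"
    and K: "\<And>x t. ((\<lambda>t. K (x - (y + t *\<^sub>R b))) has_real_derivative K' (x - (y + t *\<^sub>R b))) (at t)"
    and cont: "continuous_on UNIV K" "continuous_on UNIV K'"
  shows "((\<lambda>t. integral (cbox c d) (\<lambda>x. u x * K (x - (y + t *\<^sub>R b)))) has_real_derivative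
      integral (cbox c d) (\<lambda>x. u x * K' (x - (y + t *\<^sub>R b)))) (at t)"
proof (rule leibniz_rule_field_derivative[where U=UNIV, simplified])
  fix s x assume "x \<in> cbox c d"
  show "((\<lambda>s. u x * K (x - (y + s *\<^sub>R b))) has_real_derivative u x * K' (x - (y + s *\<^sub>R b))) (at s)"
    by (rule DERIV_cmult[OF K])
next
  fix s
  show "(\<lambda>x. u x * K (x - (y + s *\<^sub>R b))) integrable_on cbox c d"
    by (intro integrable_continuous continuous_intros u continuous_on_compose2[OF cont(1)]) auto
next
  show "continuous_on (UNIV \<times> cbox c d) (\<lambda>(s, x). u x * K' (x - (y + s *\<^sub>R b)))"
    unfolding split_beta
    by (intro continuous_intros continuous_on_compose2[OF u] continuous_on_compose2[OF cont(2)]) auto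
qed

lemma integral_cbox_eq_lborel:
  fixes h :: "'a::euclidean_space \<Rightarrow> real"
  assumes "continuous_on (cbox c d) h" "cbox c d \<subseteq> S" "\<And>x. x \<in> S \<Longrightarrow> x \<notin> cbox c d \<Longrightarrow> h x = 0"
  shows "(LINT x:S|lborel. h x) = integral (cbox c d) h"
proof -
  have "set_integrable lborel (cbox c d) h"
    unfolding set_integrable_def using borel_integrable_compact[OF compact_cbox assms(1)] by simp
  from set_borel_integral_eq_integral(2)[OF this]
  have "(LINT x:cbox c d|lborel. h x) = integral (cbox c d) h" .
  moreover have "indicator S x *\<^sub>R h x = indicator (cbox c d) x *\<^sub>R h x" for x
    using assms(2,3) by (auto simp: indicator_def)
  ultimately show ?thesis unfolding set_lebesgue_integral_def by presburger
qed

text \<open>The type argument supplies the dimension of the space over which the bump is integrated.\<close>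

definition bump_mass :: "'a::euclidean_space itself \<Rightarrow> real \<Rightarrow> real"
  where "bump_mass _ \<epsilon> = (LINT x|lborel. bump 0 \<epsilon> (x :: 'a))"

lemma bump_mass_eq:
  fixes y :: "'a::euclidean_space"
  assumes "0 \<le> \<epsilon>" "cball y \<epsilon> \<subseteq> cbox c d"
  shows "integral (cbox c d) (\<lambda>x. bump 0 \<epsilon> (x - y)) = bump_mass TYPE('a) \<epsilon>"
proof -
  have "integral (cbox c d) (\<lambda>x. bump 0 \<epsilon> (x - y)) = (LINT x:UNIV|lborel. bump 0 \<epsilon> (x - y))"
    using assms bump_zero[OF assms(1)]
    by (subst integral_cbox_eq_lborel[where c=c and d=d])
      (force intro!: continuous_intros simp: dist_norm norm_minus_commute)+
  also have "\<dots> = (LINT x|distr lborel borel ((+) y). bump 0 \<epsilon> (x - y))"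
    by (simp add: lborel_distr_plus set_lebesgue_integral_def)
  also have "\<dots> = bump_mass TYPE('a) \<epsilon>"
    unfolding bump_mass_def
    by (subst integral_distr)
      (auto intro!: borel_measurable_continuous_onI continuous_intros)
  finally show ?thesis .
qed

lemma bump_nonneg: "0 \<le> bump m \<epsilon> v" by (simp add: bump_def flat_exp_nonneg)

lemma bump_mass_pos:
  assumes "0 < \<epsilon>" shows "0 < bump_mass TYPE('a::euclidean_space) \<epsilon>"
proof -
  have "bounded (cball (0::'a) \<epsilon>)" by simp
  then obtain a :: 'a where a: "cball 0 \<epsilon> \<subseteq> box (-a) a"
    using bounded_subset_box_symmetric by blast
  then have a': "cball 0 \<epsilon> \<subseteq> cbox (-a) a" using box_subset_cbox by blast
  have ne: "box (-a) a \<noteq> {}" using a assms by auto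
  have 0: "bump 0 \<epsilon> (0::'a) \<noteq> 0" using assms by (simp add: bump_def flat_exp_def)
  have "integral (cbox (-a) a) (bump 0 \<epsilon>) \<noteq> 0"
  proof
    assume "integral (cbox (-a) a) (bump 0 \<epsilon>) = 0"
    moreover have "bump 0 \<epsilon> integrable_on cbox (-a) a"
      by (intro integrable_continuous continuous_intros)
    ultimately have "(bump 0 \<epsilon> has_integral 0) (cbox (-a) a)"
      by (metis integrable_integral)
    moreover have "(0::'a) \<in> cbox (-a) a" using a' assms by auto
    moreover have "continuous_on (cbox (-a) a) (bump 0 \<epsilon>)" by (intro continuous_intros)
    ultimately show False
      using has_integral_0_cbox_imp_0[of "-a" a "bump 0 \<epsilon>" 0] bump_nonneg ne 0 by blast
  qed
  moreover have "integral (cbox (-a) a) (bump 0 \<epsilon>) \<ge> 0"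
    by (intro integral_nonneg integrable_continuous continuous_intros bump_nonneg)
  ultimately show ?thesis using bump_mass_eq[of \<epsilon> "0::'a" "-a" a] a' assms by simp
qed

lemma mollified_le:
  fixes y :: "'a::euclidean_space"
  assumes "0 < \<epsilon>" "cball y \<epsilon> \<subseteq> cbox c d" "continuous_on (cbox c d) u"
    and le: "\<And>x. x \<in> cball y \<epsilon> \<Longrightarrow> u x \<le> k"
  shows "integral (cbox c d) (\<lambda>x. u x * bump 0 \<epsilon> (x - y)) \<le> k * bump_mass TYPE('a) \<epsilon>"
proof -
  have "integral (cbox c d) (\<lambda>x. u x * bump 0 \<epsilon> (x - y))
      \<le> integral (cbox c d) (\<lambda>x. k * bump 0 \<epsilon> (x - y))"
  proof (intro integral_le integrable_continuous continuous_intros assms)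
    fix x assume "x \<in> cbox c d"
    show "u x * bump 0 \<epsilon> (x - y) \<le> k * bump 0 \<epsilon> (x - y)"
    proof (cases "x \<in> cball y \<epsilon>")
      case True then show ?thesis by (intro mult_right_mono le bump_nonneg)
    next
      case False then show ?thesis
        using bump_zero[of \<epsilon> "x - y" 0] assms(1) by (simp add: dist_norm norm_minus_commute)
    qed
  qed
  then show ?thesis using bump_mass_eq[OF _ assms(2)] assms(1) by simp
qed

lemma mollified_ge:
  fixes y :: "'a::euclidean_space"
  assumes "0 < \<epsilon>" "cball y \<epsilon> \<subseteq> cbox c d" "continuous_on (cbox c d) u"
    and ge: "\<And>x. x \<in> cball y \<epsilon> \<Longrightarrow> k \<le> u x"
  shows "k * bump_mass TYPE('a) \<epsilon> \<le> integral (cbox c d) (\<lambda>x. u x * bump 0 \<epsilon> (x - y))"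
  using mollified_le[OF assms(1,2), of "\<lambda>x. - u x" "- k"] assms(3) ge by (simp add: continuous_on_minus)

definition weak_laplace :: "'a::euclidean_space set \<Rightarrow> ('a \<Rightarrow> real) \<Rightarrow> ('a \<Rightarrow> real) \<Rightarrow> bool"
  where "weak_laplace \<Omega> u f \<longleftrightarrow> open \<Omega> \<and> continuous_on \<Omega> u \<and> continuous_on \<Omega> f \<and>
    (\<forall>\<phi>. test_function \<Omega> \<phi> \<longrightarrow>
        (LINT x:\<Omega>|lborel. u x * laplacian \<phi> x) = (LINT x:\<Omega>|lborel. f x * \<phi> x))"

lemma bump_partial2_zero: "0 \<le> \<epsilon> \<Longrightarrow> \<epsilon> \<le> norm v \<Longrightarrow> bump_partial2 \<epsilon> b v = 0"
  by (simp add: bump_partial2_def bump_zero)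

text \<open>The distributional equation, tested with the bump centred at \<open>y\<close>: the Laplacian of the
  mollification of \<open>u\<close> is the mollification of \<open>f\<close>.\<close>

lemma mollified_laplacian:
  fixes y :: "'a::euclidean_space"
  assumes w: "weak_laplace \<Omega> u f" and e: "0 < \<epsilon>" "cball y \<epsilon> \<subseteq> cbox c d" "cbox c d \<subseteq> \<Omega>"
  shows "(\<Sum>b\<in>Basis. integral (cbox c d) (\<lambda>x. u x * bump_partial2 \<epsilon> b (x - y)))
    = integral (cbox c d) (\<lambda>x. f x * bump 0 \<epsilon> (x - y))"
proof -
  have cu: "continuous_on (cbox c d) u" and cf: "continuous_on (cbox c d) f"
    using w e(3) continuous_on_subset unfolding weak_laplace_def by blast+
  have out: "\<epsilon> \<le> norm (x - y)" if "x \<notin> cbox c d" for x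
    using that e(2) by (force simp: dist_norm norm_minus_commute)
  have "(\<Sum>b\<in>Basis. integral (cbox c d) (\<lambda>x. u x * bump_partial2 \<epsilon> b (x - y)))
    = integral (cbox c d) (\<lambda>x. \<Sum>b\<in>Basis. u x * bump_partial2 \<epsilon> b (x - y))"
    by (intro integral_sum[symmetric] integrable_continuous continuous_intros cu) auto
  also have "\<dots> = integral (cbox c d) (\<lambda>x. u x * laplacian (\<lambda>x. bump 0 \<epsilon> (x - y)) x)"
    by (simp add: bump_laplacian sum_distrib_left)
  also have "\<dots> = (LINT x:\<Omega>|lborel. u x * laplacian (\<lambda>x. bump 0 \<epsilon> (x - y)) x)"
    using e out by (intro integral_cbox_eq_lborel[symmetric])
      (auto simp: bump_laplacian bump_partial2_zero intro!: continuous_intros cu sum.neutral)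
  also have "\<dots> = (LINT x:\<Omega>|lborel. f x * bump 0 \<epsilon> (x - y))"
    using w bump_test_function[of \<epsilon> y \<Omega>] e unfolding weak_laplace_def by auto
  also have "\<dots> = integral (cbox c d) (\<lambda>x. f x * bump 0 \<epsilon> (x - y))"
    using e out by (intro integral_cbox_eq_lborel) (auto simp: bump_zero intro!: continuous_intros cf)
  finally show ?thesis .
qed

lemma second_deriv_local_max:
  fixes \<phi> :: "real \<Rightarrow> real"
  assumes "0 < d" and D1: "\<And>t. \<bar>t\<bar> < d \<Longrightarrow> (\<phi> has_real_derivative \<phi>' t) (at t)"
    and D2: "(\<phi>' has_real_derivative l) (at 0)"
    and max: "\<And>t. \<bar>t\<bar> < d \<Longrightarrow> \<phi> t \<le> \<phi> 0"
  shows "l \<le> 0"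
proof (rule ccontr)
  assume "\<not> l \<le> 0"
  then obtain e where e: "e > 0" "\<And>h. 0 < h \<Longrightarrow> h < e \<Longrightarrow> \<phi>' 0 < \<phi>' h"
    using DERIV_pos_inc_right[OF D2] by auto
  have "\<phi>' 0 = 0" using DERIV_local_max[of \<phi> "\<phi>' 0" 0 d] assms by auto
  define h where "h = min d e / 2"
  have h: "0 < h" "h < d" "h < e" using assms(1) e(1) by (auto simp: h_def min_def)
  obtain s where s: "0 < s" "s < h" "\<phi> h - \<phi> 0 = (h - 0) * \<phi>' s"
    using MVT2[of 0 h \<phi> \<phi>'] h D1 by auto
  then have "\<phi> h > \<phi> 0" using e(2)[of s] h \<open>\<phi>' 0 = 0\<close> by (smt (verit) mult_pos_pos)
  then show False using max[of h] h by auto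
qed

text \<open>The maximum principle in the form that a barrier argument consumes: at a point near which the
  Laplacian of \<open>u\<close> exceeds that of \<open>w\<close>, the difference \<open>u - w\<close> has no local maximum. A maximum would
  become strict after subtracting a small paraboloid, hence persist nearby for the mollification of
  \<open>u\<close>, and there the second derivative test contradicts the inequality between the Laplacians. The
  comparison function only has to be differentiable twice along the coordinate directions.\<close>

lemma no_local_max:
  fixes u w :: "'a::euclidean_space \<Rightarrow> real"
  assumes wl: "weak_laplace \<Omega> u f" and R: "0 < R" "cball z R \<subseteq> \<Omega>"
    and f: "\<And>y. y \<in> cball z R \<Longrightarrow> m \<le> f y"
    and w: "continuous_on (cball z R) w"
    and w1: "\<And>y b. y \<in> ball z R \<Longrightarrow> b \<in> Basis \<Longrightarrow>
      ((\<lambda>t. w (y + t *\<^sub>R b)) has_real_derivative w1 b y) (at 0)"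
    and w2: "\<And>y b. y \<in> ball z R \<Longrightarrow> b \<in> Basis \<Longrightarrow>
      ((\<lambda>t. w1 b (y + t *\<^sub>R b)) has_real_derivative w2 b y) (at 0)"
    and lap: "\<And>y. y \<in> ball z R \<Longrightarrow> (\<Sum>b\<in>Basis. w2 b y) \<le> m'" and "m' < m"
  shows "\<exists>y\<in>cball z R. u z - w z < u y - w y"
proof (rule ccontr)
  assume "\<not> ?thesis"
  then have max: "u y - w y \<le> u z - w z" if "y \<in> cball z R" for y using that by force
  define \<eta> where "\<eta> = (m - m') / (4 * DIM('a))"
  have \<eta>: "0 < \<eta>" "2 * DIM('a) * \<eta> < m - m'"
    using \<open>m' < m\<close> by (auto simp: \<eta>_def field_simps)
  obtain c d where cd: "z \<in> box c d" "cbox c d \<subseteq> ball z R"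
    by (rule open_contains_cbox[of "ball z R" z]) (use R(1) in auto)
  obtain \<rho>0 where \<rho>0: "\<rho>0 > 0" "ball z \<rho>0 \<subseteq> box c d"
    using cd(1) openE[OF open_box] by blast
  define \<rho> where "\<rho> = \<rho>0 / 3"
  have \<rho>: "0 < \<rho>" "cball z (2 * \<rho>) \<subseteq> cbox c d"
    using \<rho>0 box_subset_cbox[of c d] by (auto simp: \<rho>_def subset_eq)
  have zR: "ball z \<rho> \<subseteq> ball z R" "cball z \<rho> \<subseteq> cball z R" "cball z \<rho> \<subseteq> cbox c d"
  proof -
    show *: "cball z \<rho> \<subseteq> cbox c d" using \<rho> by (auto simp: subset_eq)
    then show "ball z \<rho> \<subseteq> ball z R" "cball z \<rho> \<subseteq> cball z R"
      using cd(2) ball_subset_cball by blast+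
  qed
  have cO: "cbox c d \<subseteq> \<Omega>" using cd(2) R(2) ball_subset_cball by blast
  have cu: "continuous_on (cbox c d) u" and cf: "continuous_on (cbox c d) f"
    using wl cO continuous_on_subset unfolding weak_laplace_def by blast+
  \<comment> \<open>The error \<open>2 * \<tau>\<close> of the mollification stays below the gain \<open>\<eta> * \<rho>\<^sup>2\<close> on the sphere, which keeps the maximum inside.\<close>
  define \<tau> where "\<tau> = \<eta> * \<rho>\<^sup>2 / 4"
  have "\<tau> > 0" using \<eta> \<rho> by (simp add: \<tau>_def)
  have "uniformly_continuous_on (cbox c d) u"
    by (rule compact_uniformly_continuous[OF cu compact_cbox])
  then obtain e where e: "e > 0"
      "\<And>x x'. x \<in> cbox c d \<Longrightarrow> x' \<in> cbox c d \<Longrightarrow> dist x' x < e \<Longrightarrow> dist (u x') (u x) < \<tau>"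
    using \<open>\<tau> > 0\<close> unfolding uniformly_continuous_on_def by metis
  define \<epsilon> where "\<epsilon> = min \<rho> (e / 2)"
  have \<epsilon>: "0 < \<epsilon>" "\<epsilon> \<le> \<rho>" "\<epsilon> < e" using \<rho> e by (auto simp: \<epsilon>_def min_def)
  define I where "I = bump_mass TYPE('a) \<epsilon>"
  have I: "I > 0" unfolding I_def by (rule bump_mass_pos[OF \<epsilon>(1)])
  have ball_in: "cball y \<epsilon> \<subseteq> cbox c d" if "y \<in> cball z \<rho>" for y
  proof
    fix x assume "x \<in> cball y \<epsilon>"
    then have "dist z x \<le> 2 * \<rho>" using that \<epsilon>(2) dist_triangle[of z x y] by auto
    then show "x \<in> cbox c d" using \<rho>(2) by auto
  qed
  define U where "U y = integral (cbox c d) (\<lambda>x. u x * bump 0 \<epsilon> (x - y)) / I" for y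
  define U1 where "U1 b y = integral (cbox c d) (\<lambda>x. u x * - bump_partial \<epsilon> b (x - y)) / I" for b y
  define U2 where "U2 b y = integral (cbox c d) (\<lambda>x. u x * bump_partial2 \<epsilon> b (x - y)) / I" for b y
  have U_close: "\<bar>U y - u y\<bar> \<le> \<tau>" if y: "y \<in> cball z \<rho>" for y
  proof -
    have c: "\<bar>u x - u y\<bar> < \<tau>" if "x \<in> cball y \<epsilon>" for x
      using e(2)[of y x] that ball_in[OF y] \<epsilon> y zR(3) by (force simp: dist_real_def dist_commute)
    have "U y \<le> u y + \<tau>" "u y - \<tau> \<le> U y"
      unfolding U_def using mollified_le[OF \<epsilon>(1) ball_in[OF y] cu, of "u y + \<tau>"]
        mollified_ge[OF \<epsilon>(1) ball_in[OF y] cu, of "u y - \<tau>"] c I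
      by (force simp: I_def field_simps abs_less_iff)+
    then show ?thesis by linarith
  qed
  define F where "F y = U y - w y - \<eta> * ((y - z) \<bullet> (y - z))" for y
  have "continuous_on (cball z \<rho>) U"
    unfolding U_def divide_inverse
    by (intro continuous_intros integral_continuous_on_param)
      (auto simp: split_beta intro!: continuous_intros continuous_on_compose2[OF cu])
  then have "continuous_on (cball z \<rho>) F"
    unfolding F_def by (intro continuous_intros continuous_on_subset[OF w zR(2)])
  then obtain y1 where y1: "y1 \<in> cball z \<rho>" "\<And>y. y \<in> cball z \<rho> \<Longrightarrow> F y \<le> F y1"
    using continuous_attains_sup[of "cball z \<rho>" F] \<rho>(1) by (auto simp: Ball_def)
  have "y1 \<in> ball z \<rho>"
  proof (rule ccontr)
    assume "y1 \<notin> ball z \<rho>"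
    then have "norm (y1 - z) = \<rho>" using y1(1) by (auto simp: dist_norm norm_minus_commute)
    then have "F y1 = U y1 - w y1 - \<eta> * \<rho>\<^sup>2" by (simp add: F_def flip: power2_norm_eq_inner)
    moreover have "F z = U z - w z" by (simp add: F_def)
    moreover have "u y1 - w y1 \<le> u z - w z" using max y1(1) zR(2) by blast
    moreover have "F z \<le> F y1" using y1(2) \<rho>(1) by simp
    ultimately have "\<eta> * \<rho>\<^sup>2 \<le> 2 * \<tau>" using U_close[OF y1(1)] U_close[of z] \<rho>(1) by auto
    then show False using \<open>\<tau> > 0\<close> by (simp add: \<tau>_def)
  qed
  then obtain \<delta> where d: "\<delta> > 0" "ball y1 \<delta> \<subseteq> ball z \<rho>" by (meson open_ball open_contains_ball)
  have le: "U2 b y1 - w2 b y1 - 2 * \<eta> \<le> 0" if b: "b \<in> Basis" for b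
  proof (rule second_deriv_local_max[OF d(1)])
    have in_b: "y1 + t *\<^sub>R b \<in> ball z \<rho>" if "\<bar>t\<bar> < \<delta>" for t
      using d(2) that b by (auto simp: subset_eq dist_norm)
    show "F (y1 + t *\<^sub>R b) \<le> F (y1 + 0 *\<^sub>R b)" if "\<bar>t\<bar> < \<delta>" for t
      using y1(2) in_b[OF that] by auto
    have bb: "b \<bullet> b = 1" using b by simp
    show "((\<lambda>t. F (y1 + t *\<^sub>R b)) has_real_derivative
        U1 b (y1 + t *\<^sub>R b) - w1 b (y1 + t *\<^sub>R b) - 2 * \<eta> * ((y1 + t *\<^sub>R b - z) \<bullet> b)) (at t)"
      if t: "\<bar>t\<bar> < \<delta>" for t
    proof -
      have "((\<lambda>s. w (y1 + s *\<^sub>R b)) has_real_derivative w1 b (y1 + t *\<^sub>R b)) (at t)"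
        using w1[of "y1 + t *\<^sub>R b" b] in_b[OF t] zR(1) b
          DERIV_shift[of "\<lambda>s. w (y1 + s *\<^sub>R b)" "w1 b (y1 + t *\<^sub>R b)" 0 t]
        by (auto simp: algebra_simps)
      moreover have "((\<lambda>s. U (y1 + s *\<^sub>R b)) has_real_derivative U1 b (y1 + t *\<^sub>R b)) (at t)"
        unfolding U_def U1_def divide_inverse
        by (intro DERIV_cmult_right mollified_line_deriv cu bump_line_deriv1 continuous_intros)
      ultimately show ?thesis unfolding F_def
        by (auto intro!: derivative_eq_intros simp: algebra_simps inner_commute)
    qed
    have "((\<lambda>t. U1 b (y1 + t *\<^sub>R b)) has_real_derivative U2 b (y1 + 0 *\<^sub>R b)) (at 0)"
      unfolding U1_def U2_def divide_inverse
      by (intro DERIV_cmult_right mollified_line_deriv cu bump_line_deriv2 continuous_intros)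
    moreover have "((\<lambda>t. w1 b (y1 + t *\<^sub>R b)) has_real_derivative w2 b y1) (at 0)"
      using w2[of y1 b] b \<open>y1 \<in> ball z \<rho>\<close> zR(1) by blast
    ultimately show "((\<lambda>t. U1 b (y1 + t *\<^sub>R b) - w1 b (y1 + t *\<^sub>R b) - 2 * \<eta> * ((y1 + t *\<^sub>R b - z) \<bullet> b))
        has_real_derivative U2 b y1 - w2 b y1 - 2 * \<eta>) (at 0)"
      using bb by (auto intro!: derivative_eq_intros simp: algebra_simps)
  qed
  have "(\<Sum>b\<in>Basis. U2 b y1) \<le> (\<Sum>b\<in>Basis. w2 b y1 + 2 * \<eta>)"
    by (rule sum_mono) (use le in force)
  also have "\<dots> = (\<Sum>b\<in>Basis. w2 b y1) + 2 * DIM('a) * \<eta>" by (simp add: sum.distrib)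
  also have "\<dots> < m" using lap[of y1] \<open>y1 \<in> ball z \<rho>\<close> zR(1) \<eta>(2) by fastforce
  finally have "(\<Sum>b\<in>Basis. U2 b y1) < m" .
  moreover have "(\<Sum>b\<in>Basis. U2 b y1) = integral (cbox c d) (\<lambda>x. f x * bump 0 \<epsilon> (x - y1)) / I"
    using mollified_laplacian[OF wl \<epsilon>(1) ball_in[OF y1(1)] cO] by (simp add: U2_def flip: sum_divide_distrib)
  moreover have "m * I \<le> integral (cbox c d) (\<lambda>x. f x * bump 0 \<epsilon> (x - y1))"
    unfolding I_def using ball_in[OF y1(1)] cd(2) ball_subset_cball
    by (intro mollified_ge \<epsilon>(1) cf f) blast+
  ultimately show False using I by (simp add: field_simps)
qed

section \<open>Superlinear growth from the Keller--Osserman condition\<close>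


text \<open>The hypotheses on \<open>g x\<close> for a single \<open>x\<close>; \<open>integral {0..t} h\<close> is the primitive \<open>G\<close>.\<close>

definition KO_fun :: "real \<Rightarrow> (real \<Rightarrow> real) \<Rightarrow> bool"
  where "KO_fun C h \<longleftrightarrow> 1 \<le> C \<and> continuous_on {0..} h \<and> mono_on {0..} h \<and> (\<forall>t\<ge>0. 0 \<le> h t) \<and>
    (\<forall>a>0. C * a \<le> h a \<longrightarrow>
      (\<integral>\<^sup>+t\<in>{2*a..}. ennreal (1 / sqrt (integral {0..t} h)) \<partial>lborel) \<le> ennreal (C * sqrt (a / h a)))"

lemma KO_funD:
  assumes "KO_fun C h"
  shows "1 \<le> C" "continuous_on {0..} h" "\<And>s t. 0 \<le> s \<Longrightarrow> s \<le> t \<Longrightarrow> h s \<le> h t" "\<And>t. 0 \<le> t \<Longrightarrow> 0 \<le> h t"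
    "\<And>a. 0 < a \<Longrightarrow> C * a \<le> h a \<Longrightarrow>
      (\<integral>\<^sup>+t\<in>{2*a..}. ennreal (1 / sqrt (integral {0..t} h)) \<partial>lborel) \<le> ennreal (C * sqrt (a / h a))"
  using assms unfolding KO_fun_def mono_on_def by auto

text \<open>If \<open>h t \<le> t / k\<^sup>2\<close> then \<open>G t \<le> t * h t \<le> (t / k)\<^sup>2\<close>, so the integrand of the Keller--Osserman integral is
  at least \<open>k / t\<close>, whose integral is a logarithm. A long interval on which \<open>h\<close> grows only linearly is
  therefore excluded.\<close>

lemma KO_log:
  assumes K: "KO_fun C h" and a: "0 < a" "C * a \<le> h a" and I: "2 * a \<le> \<alpha>" "\<alpha> \<le> \<beta>"
    and k: "0 \<le> k" "\<And>t. \<alpha> \<le> t \<Longrightarrow> t \<le> \<beta> \<Longrightarrow> k\<^sup>2 * h t \<le> t"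
  shows "k * ln (\<beta> / \<alpha>) \<le> C * sqrt (a / h a)"
proof -
  note KD = KO_funD[OF K]
  have ha: "0 < h a" using a KD(1) by (smt (verit) mult_pos_pos)
  have int: "h integrable_on {s..t}" if "0 \<le> s" for s t
    by (rule integrable_continuous_real, rule continuous_on_subset[OF KD(2)]) (use that in auto)
  have G: "0 < integral {0..t} h \<and> k\<^sup>2 * integral {0..t} h \<le> t\<^sup>2" if t: "\<alpha> \<le> t" "t \<le> \<beta>" for t
  proof
    have "0 < (t - a) * h a" using t I a ha by simp
    also have "\<dots> = integral {a..t} (\<lambda>_. h a)" using t I a by simp
    also have "\<dots> \<le> integral {a..t} h"
      using a by (intro integral_le int KD(3)) auto
    also have "\<dots> \<le> integral {0..t} h"
      using a by (intro integral_subset_le int) (auto intro: KD(4))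
    finally show "0 < integral {0..t} h" .
    have "integral {0..t} h \<le> integral {0..t} (\<lambda>_. h t)"
      using t by (intro integral_le int KD(3)) auto
    also have "\<dots> = t * h t" using t I a by simp
    finally have "k\<^sup>2 * integral {0..t} h \<le> k\<^sup>2 * (t * h t)" by (rule mult_left_mono) simp
    also have "\<dots> = t * (k\<^sup>2 * h t)" by simp
    also have "\<dots> \<le> t * t" using t I a k(2)[OF t] by (intro mult_left_mono) auto
    finally show "k\<^sup>2 * integral {0..t} h \<le> t\<^sup>2" by (simp add: power2_eq_square)
  qed
  have G': "k * (1 / t) \<le> 1 / sqrt (integral {0..t} h)" if t: "\<alpha> \<le> t" "t \<le> \<beta>" for t
  proof -
    have "sqrt (k\<^sup>2 * integral {0..t} h) \<le> sqrt (t\<^sup>2)" using G[OF t] by (intro real_sqrt_le_mono) auto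
    then have "k * sqrt (integral {0..t} h) \<le> t"
      using k(1) t I a by (simp add: real_sqrt_mult)
    then show ?thesis using G[OF t] t I a by (simp add: field_simps)
  qed
  have "ennreal (k * ln \<beta> - k * ln \<alpha>) = (\<integral>\<^sup>+t\<in>{\<alpha>..\<beta>}. ennreal (k * (1 / t)) \<partial>lborel)"
    using I a k(1)
    by (intro nn_integral_FTC_Icc[symmetric]) (auto intro!: derivative_eq_intros)
  also have "\<dots> \<le> (\<integral>\<^sup>+t\<in>{2*a..}. ennreal (1 / sqrt (integral {0..t} h)) \<partial>lborel)"
    using G' I by (intro nn_integral_mono) (auto split: split_indicator intro!: ennreal_leI)
  also have "\<dots> \<le> ennreal (C * sqrt (a / h a))" by (rule KD(5)[OF a])
  finally have "k * ln \<beta> - k * ln \<alpha> \<le> C * sqrt (a / h a)"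
    using KD(1) a ha by (subst (asm) ennreal_le_iff) auto
  then show ?thesis using I a by (simp add: ln_div algebra_simps)
qed

text \<open>Apart from a factor, \<open>h t / t\<close> is increasing beyond \<open>a\<close>. For \<open>t \<ge> 4 * a\<close> the bound comes from the part of
  the integral over \<open>{t / 2..t}\<close>.\<close>

lemma KO_quotient_quasi_mono:
  assumes K: "KO_fun C h" and a: "0 < a" "C * a \<le> h a" and t: "a \<le> t"
  shows "h a * t \<le> 8 * C\<^sup>2 * h t * a"
proof -
  note KD = KO_funD[OF K]
  have ha: "0 < h a" using a KD(1) by (smt (verit) mult_pos_pos)
  have ht: "h a \<le> h t" using KD(3) a t by simp
  have C2: "1 \<le> C\<^sup>2" using KD(1) by simp
  show ?thesis
  proof (cases "t \<le> 4 * a")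
    case True
    have "h a * t \<le> h t * (4 * a)" using ht ha a True t by (intro mult_mono) auto
    also have "\<dots> \<le> (8 * C\<^sup>2) * (h t * a)"
      using mult_right_mono[of 4 "8 * C\<^sup>2" "h t * a"] C2 ht ha a by simp
    finally show ?thesis by (simp add: mult_ac)
  next
    case False
    define k where "k = sqrt (t / (2 * h t))"
    have k2: "k\<^sup>2 = t / (2 * h t)" using t a ht ha by (simp add: k_def)
    have "k * ln (t / (t / 2)) \<le> C * sqrt (a / h a)"
    proof (rule KO_log[OF K a])
      fix s assume s: "t / 2 \<le> s" "s \<le> t"
      have "k\<^sup>2 * h s \<le> k\<^sup>2 * h t" using KD(3) s t a by (intro mult_left_mono) auto
      also have "\<dots> = t / 2" using ht ha by (simp add: k2)
      finally show "k\<^sup>2 * h s \<le> s" using s by simp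
    qed (use False a t ht ha in \<open>auto simp: k_def\<close>)
    then have *: "k * ln 2 \<le> C * sqrt (a / h a)" using t a by simp
    have "k * (1 / 2) \<le> k * ln 2"
      using ln2_ge_two_thirds t a ht ha by (intro mult_left_mono) (auto simp: k_def)
    then have "k / 2 \<le> C * sqrt (a / h a)" using * by simp
    then have "(k / 2)\<^sup>2 \<le> (C * sqrt (a / h a))\<^sup>2"
      using t a ht ha by (intro power_mono) (auto simp: k_def)
    then have "t / (8 * h t) \<le> C\<^sup>2 * (a / h a)"
      using a ha by (simp add: power_mult_distrib power_divide k2)
    then show ?thesis using ha ht by (simp add: field_simps)
  qed
qed

text \<open>Quasi-monotonicity bounds \<open>h\<close> on \<open>{2 * a..\<Lambda> * a}\<close> by a linear function whose slope is a multiple of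
  \<open>h (\<Lambda> * a) / (\<Lambda> * a)\<close>. The integral over that interval contributes \<open>ln (\<Lambda> / 2)\<close>, so a large \<open>\<Lambda>\<close> forces the
  quotient \<open>h t / t\<close> to gain the factor 4 between \<open>a\<close> and \<open>\<Lambda> * a\<close>.\<close>

lemma KO_superlinear:
  assumes K: "KO_fun C h" and a: "0 < a" "8 * C ^ 3 * a \<le> h a"
  shows "4 * (2 * exp (6 * C\<^sup>2)) * h a \<le> h (2 * exp (6 * C\<^sup>2) * a)"
proof -
  note KD = KO_funD[OF K]
  define \<Lambda> where "\<Lambda> = 2 * exp (6 * C\<^sup>2)"
  have \<Lambda>: "2 \<le> \<Lambda>" by (simp add: \<Lambda>_def)
  have C1: "C \<le> 8 * C ^ 3" using KD(1) self_le_power[of C 3] by simp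
  have a': "C * a \<le> h a" using mult_right_mono[OF C1, of a] a by linarith
  have ha: "0 < h a" using a' a KD(1) by (smt (verit) mult_pos_pos)
  have lb: "C * t \<le> h t" if "a \<le> t" for t
  proof -
    have "(8 * C\<^sup>2 * a) * (C * t) = (8 * C ^ 3 * a) * t" by (simp add: power_numeral_reduce)
    also have "\<dots> \<le> h a * t" using a that by (intro mult_right_mono) auto
    also have "\<dots> \<le> (8 * C\<^sup>2 * a) * h t" using KO_quotient_quasi_mono[OF K a(1) a' that] by (simp add: mult_ac)
    finally show ?thesis using a KD(1) by simp
  qed
  define Q where "Q = h (\<Lambda> * a) / (\<Lambda> * a)"
  have Q: "0 < Q" using KD(3)[of a "\<Lambda> * a"] ha a \<Lambda> unfolding Q_def by auto
  define k where "k = sqrt (1 / (8 * C\<^sup>2 * Q))"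
  have k2: "k\<^sup>2 = 1 / (8 * C\<^sup>2 * Q)" using Q by (simp add: k_def)
  have "k * ln (\<Lambda> * a / (2 * a)) \<le> C * sqrt (a / h a)"
  proof (rule KO_log[OF K a(1) a'])
    fix s assume s: "2 * a \<le> s" "s \<le> \<Lambda> * a"
    have "h s * (\<Lambda> * a) \<le> 8 * C\<^sup>2 * h (\<Lambda> * a) * s"
      using KO_quotient_quasi_mono[OF K _ lb, of s "\<Lambda> * a"] s a by simp
    then show "k\<^sup>2 * h s \<le> s" using Q KD(1) a \<Lambda> by (simp add: k2 Q_def field_simps)
  qed (use a \<Lambda> Q in \<open>auto simp: k_def\<close>)
  moreover have "ln (\<Lambda> * a / (2 * a)) = 6 * C\<^sup>2" using a by (simp add: \<Lambda>_def)
  ultimately have "k * (6 * C\<^sup>2) \<le> C * sqrt (a / h a)" by simp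
  then have "(k * (6 * C\<^sup>2))\<^sup>2 \<le> (C * sqrt (a / h a))\<^sup>2"
    using Q by (intro power_mono) (auto simp: k_def)
  then have "36 * C ^ 4 / (8 * C\<^sup>2 * Q) \<le> C\<^sup>2 * (a / h a)"
    using a ha by (simp add: power_mult_distrib k2)
  then have "36 * C ^ 4 * h a \<le> C\<^sup>2 * a * (8 * C\<^sup>2 * Q)" using Q KD(1) ha by (simp add: field_simps)
  also have "\<dots> = C ^ 4 * (8 * a * Q)" by (simp add: power_numeral_reduce)
  finally have "36 * h a \<le> 8 * a * Q" using KD(1) by simp
  then have "4 * h a \<le> a * Q" using ha mult.assoc[of 8 a Q] by linarith
  then show ?thesis using a \<Lambda> by (simp add: Q_def field_simps flip: \<Lambda>_def)
qed

lemma ex_power_of_2_bracket: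
  assumes "1 \<le> (X::real)" obtains j :: nat where "2 ^ j \<le> X" "X < 2 ^ Suc j"
proof -
  obtain n where "X < 2 ^ n" using real_arch_pow[of 2 X] by auto
  then have "X < 2 ^ (LEAST n. X < 2 ^ n)" by (rule LeastI)
  then obtain j where j: "(LEAST n. X < 2 ^ n) = Suc j" "X < 2 ^ Suc j"
    using assms by (cases "LEAST n. X < 2 ^ n") auto
  then have "\<not> X < 2 ^ j" using not_less_Least[of j "\<lambda>n. X < 2 ^ n"] by simp
  then show ?thesis using that[of j] j(2) by (simp add: not_less)
qed

text \<open>Iterating \<open>KO_superlinear\<close>: with \<open>2 ^ p > \<Lambda>\<close>, the value \<open>t \<ge> a * 2 ^ (j * p)\<close> lies beyond \<open>\<Lambda> ^ j * a\<close>, where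
  \<open>h t / t\<close> has gained the factor \<open>4 ^ j\<close>. The exponent \<open>p\<close> depends on \<open>C\<close> alone, not on \<open>h\<close>.\<close>

lemma KO_growth:
  "\<exists>p>0. \<forall>h a X t. KO_fun C h \<longrightarrow> 0 < a \<longrightarrow> 8 * C ^ 3 * a \<le> h a \<longrightarrow> 1 \<le> X \<longrightarrow>
    a * X ^ p \<le> t \<longrightarrow> X\<^sup>2 * h a * t \<le> 32 * C\<^sup>2 * h t * a"
proof -
  define \<Lambda> where "\<Lambda> = 2 * exp (6 * C\<^sup>2)"
  have \<Lambda>: "2 \<le> \<Lambda>" by (simp add: \<Lambda>_def)
  obtain p where p: "\<Lambda> < 2 ^ p" using real_arch_pow[of 2 \<Lambda>] by auto
  show ?thesis
  proof (intro exI[of _ p] conjI allI impI)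
    show "0 < p" using p \<Lambda> by (cases p) auto
  next
    fix h a X t
    assume K: "KO_fun C h" and a: "0 < a" "8 * C ^ 3 * a \<le> h a" and X: "1 \<le> X" and t: "a * X ^ p \<le> t"
    note KD = KO_funD[OF K]
    have C1: "C \<le> 8 * C ^ 3" using KD(1) self_le_power[of C 3] by simp
    have ha: "0 < h a" using a KD(1) by (smt (verit) mult_pos_pos zero_less_power)
    have it: "4 ^ j * \<Lambda> ^ j * h a \<le> h (\<Lambda> ^ j * a) \<and> 8 * C ^ 3 * (\<Lambda> ^ j * a) \<le> h (\<Lambda> ^ j * a)" for j
    proof (induction j)
      case (Suc j)
      have pos: "0 < \<Lambda> ^ j * a" using \<Lambda> a by simp
      have st: "4 * \<Lambda> * h (\<Lambda> ^ j * a) \<le> h (\<Lambda> * (\<Lambda> ^ j * a))"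
        using KO_superlinear[OF K pos] Suc unfolding \<Lambda>_def by blast
      have "4 * \<Lambda> * (4 ^ j * \<Lambda> ^ j * h a) \<le> 4 * \<Lambda> * h (\<Lambda> ^ j * a)"
        using Suc \<Lambda> by (intro mult_left_mono) auto
      moreover have "4 * \<Lambda> * (8 * C ^ 3 * (\<Lambda> ^ j * a)) \<le> 4 * \<Lambda> * h (\<Lambda> ^ j * a)"
        using Suc \<Lambda> by (intro mult_left_mono) auto
      moreover have "\<Lambda> * (8 * C ^ 3 * (\<Lambda> ^ j * a)) \<le> 4 * \<Lambda> * (8 * C ^ 3 * (\<Lambda> ^ j * a))"
        using \<Lambda> a KD(1) by (intro mult_right_mono) auto
      ultimately show ?case using st by (simp add: mult_ac)
    qed (use a in auto)
    obtain j where j: "2 ^ j \<le> X" "X < 2 ^ Suc j" using ex_power_of_2_bracket[OF X] by blast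
    have "\<Lambda> ^ j \<le> (2 ^ p) ^ j" using p \<Lambda> by (intro power_mono) auto
    also have "\<dots> = (2 ^ j) ^ p" by (simp add: mult.commute flip: power_mult)
    also have "\<dots> \<le> X ^ p" using j by (intro power_mono) auto
    finally have "\<Lambda> ^ j * a \<le> X ^ p * a" using a by (intro mult_right_mono) auto
    then have b: "\<Lambda> ^ j * a \<le> t" using t by (simp add: mult.commute)
    have pos: "0 < \<Lambda> ^ j * a" using \<Lambda> a by simp
    have "C * (\<Lambda> ^ j * a) \<le> 8 * C ^ 3 * (\<Lambda> ^ j * a)" using C1 pos by (intro mult_right_mono) auto
    then have th: "C * (\<Lambda> ^ j * a) \<le> h (\<Lambda> ^ j * a)" using it[of j] by linarith
    have "X\<^sup>2 \<le> (2 ^ Suc j)\<^sup>2" using j X by (intro power_mono) auto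
    also have "\<dots> = 4 * (4::real) ^ j"
      by (simp add: power2_eq_square flip: power_mult_distrib)
    finally have X2: "X\<^sup>2 \<le> 4 * 4 ^ j" .
    have tp: "0 < t" using pos b by linarith
    have "\<Lambda> ^ j * (X\<^sup>2 * h a * t) \<le> \<Lambda> ^ j * ((4 * 4 ^ j) * h a * t)"
      using X2 ha tp \<Lambda> by (intro mult_left_mono mult_right_mono) auto
    also have "\<dots> = 4 * ((4 ^ j * \<Lambda> ^ j * h a) * t)" by simp
    also have "\<dots> \<le> 4 * (h (\<Lambda> ^ j * a) * t)"
      using it[of j] tp by (intro mult_left_mono mult_right_mono) auto
    also have "\<dots> \<le> 4 * (8 * C\<^sup>2 * h t * (\<Lambda> ^ j * a))"
      using KO_quotient_quasi_mono[OF K pos th b] by (simp add: mult_ac)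
    finally have "\<Lambda> ^ j * (X\<^sup>2 * h a * t) \<le> \<Lambda> ^ j * (32 * C\<^sup>2 * h t * a)" by (simp add: mult_ac)
    then show "X\<^sup>2 * h a * t \<le> 32 * C\<^sup>2 * h t * a" using \<Lambda> by simp
  qed
qed

section \<open>The interior estimate\<close>


definition zero_ext :: "'a set \<Rightarrow> ('a \<Rightarrow> real) \<Rightarrow> 'a \<Rightarrow> real"
  where "zero_ext \<Omega> u x = (if x \<in> \<Omega> then u x else 0)"

lemma zero_ext_continuous:
  fixes \<Omega> :: "'a::euclidean_space set"
  assumes "open \<Omega>" "continuous_on \<Omega> u" and v: "vanishes_on \<Omega> (frontier \<Omega> \<inter> S) u"
  shows "continuous_on S (zero_ext \<Omega> u)"
proof (rule continuous_at_imp_continuous_on, rule ballI)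
  fix y assume "y \<in> S"
  consider "y \<in> \<Omega>" | "y \<in> - closure \<Omega>" | "y \<in> frontier \<Omega>"
    using assms(1) by (auto simp: frontier_def interior_open)
  then show "isCont (zero_ext \<Omega> u) y"
  proof cases
    case 1
    have "continuous_on \<Omega> (zero_ext \<Omega> u)"
      using assms(2) by (rule continuous_on_eq) (simp add: zero_ext_def)
    then show ?thesis using 1 assms(1) continuous_on_eq_continuous_at by blast
  next
    case 2
    have "continuous_on (- closure \<Omega>) (zero_ext \<Omega> u)"
      using continuous_on_const[of _ "0::real"]
      by (rule continuous_on_eq) (use closure_subset in \<open>auto simp: zero_ext_def\<close>)
    then show ?thesis using 2 by (metis continuous_on_eq_continuous_at open_Compl closed_closure)
  next
    case 3
    then have y: "zero_ext \<Omega> u y = 0" using assms(1) by (auto simp: zero_ext_def frontier_def interior_open)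
    have u0: "(u \<longlongrightarrow> 0) (at y within \<Omega>)" using v 3 \<open>y \<in> S\<close> by (auto simp: vanishes_on_def)
    show ?thesis unfolding continuous_at_eps_delta y
    proof (intro allI impI)
      fix e :: real assume "0 < e"
      then obtain d where d: "d > 0" "\<And>x. x \<in> \<Omega> \<Longrightarrow> 0 < dist x y \<Longrightarrow> dist x y < d \<Longrightarrow> dist (u x) 0 < e"
        using u0 unfolding Lim_within by meson
      have "dist (zero_ext \<Omega> u x) 0 < e" if "dist x y < d" for x
        using d(2)[of x] that y \<open>0 < e\<close> by (cases "x = y") (auto simp: zero_ext_def)
      then show "\<exists>d>0. \<forall>x'. dist x' y < d \<longrightarrow> dist (zero_ext \<Omega> u x') 0 < e" using d(1) by blast
    qed
  qed
qed

text \<open>The selection principle of the whole proof: at the maximum point \<open>z\<close>, with \<open>s = r - dist z x\<close>, the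
  function \<open>u\<close> is at most \<open>2 ^ p * u z\<close> on the ball of radius \<open>s / 2\<close>, while \<open>u z\<close> still controls \<open>u\<close> near
  the centre. One such point does the work of an infinite sequence along which \<open>u\<close> keeps doubling.\<close>

lemma weighted_max:
  fixes \<Omega> :: "'a::euclidean_space set"
  assumes \<Omega>: "open \<Omega>" "continuous_on \<Omega> u" and v: "vanishes_on \<Omega> (frontier \<Omega> \<inter> cball x r) u"
    and x: "x \<in> \<Omega>" "0 < u x" and r: "0 < r" and p: "0 < (p :: nat)"
  obtains z where "z \<in> \<Omega>" "dist z x < r" "0 < u z"
    "\<And>y. y \<in> \<Omega> \<Longrightarrow> dist y x \<le> r \<Longrightarrow> u y * (r - dist y x) ^ p \<le> u z * (r - dist z x) ^ p"
proof -
  let ?W = "\<lambda>y. zero_ext \<Omega> u y * (r - dist y x) ^ p"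
  have "continuous_on (cball x r) ?W"
    by (intro continuous_intros zero_ext_continuous \<Omega> v)
  then obtain z where z: "z \<in> cball x r" "\<And>y. y \<in> cball x r \<Longrightarrow> ?W y \<le> ?W z"
    using continuous_attains_sup[of "cball x r" ?W] r by (auto simp: Ball_def)
  have "0 < ?W x" using x r by (simp add: zero_ext_def)
  also have "\<dots> \<le> ?W z" using z(2)[of x] r by simp
  finally have W: "0 < ?W z" .
  then have zO: "z \<in> \<Omega>" by (auto simp: zero_ext_def split: if_splits)
  have "dist z x \<le> r" using z(1) by (simp add: dist_commute)
  moreover have "dist z x \<noteq> r" using W p by (auto simp: zero_power)
  ultimately have zr: "dist z x < r" by simp
  show ?thesis
  proof
    show "0 < u z" using W zO zr by (simp add: zero_ext_def zero_less_mult_iff)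
    fix y assume "y \<in> \<Omega>" "dist y x \<le> r"
    then show "u y * (r - dist y x) ^ p \<le> u z * (r - dist z x) ^ p"
      using z(2)[of y] zO by (simp add: zero_ext_def dist_commute)
  qed fact+
qed

lemma sq_dist_line_deriv:
  "((\<lambda>t. (y + t *\<^sub>R b - z) \<bullet> (y + t *\<^sub>R b - z)) has_real_derivative 2 * ((y - z) \<bullet> b)) (at 0)"
proof -
  have "(y + t *\<^sub>R b - z) \<bullet> (y + t *\<^sub>R b - z)
      = (y - z) \<bullet> (y - z) + 2 * t * ((y - z) \<bullet> b) + t\<^sup>2 * (b \<bullet> b)" for t
    by (simp add: algebra_simps inner_commute power2_eq_square)
  then show ?thesis by (auto intro!: derivative_eq_intros)
qed

lemma inner_line_deriv:
  "((\<lambda>t. (y + t *\<^sub>R b - z) \<bullet> b) has_real_derivative b \<bullet> b) (at 0)"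
proof -
  have "(y + t *\<^sub>R b - z) \<bullet> b = (y - z) \<bullet> b + t * (b \<bullet> b)" for t
    by (simp add: algebra_simps)
  then show ?thesis by (auto intro!: derivative_eq_intros)
qed

text \<open>Comparison with the paraboloid \<open>k * (dist z y)\<^sup>2\<close>, whose Laplacian is \<open>2 * k\<close> times the dimension: the
  difference cannot have an interior maximum where \<open>u \<ge> u z\<close>, so its maximum lies on the sphere.\<close>

lemma quadratic_growth:
  fixes \<Omega> :: "'a::euclidean_space set" and k m :: real
  assumes wl: "weak_laplace \<Omega> u f" and \<rho>: "0 < \<rho>" "cball z \<rho> \<subseteq> \<Omega>" and k: "0 < k"
    and f: "\<And>y. y \<in> cball z \<rho> \<Longrightarrow> u z \<le> u y \<Longrightarrow> m \<le> f y" and km: "2 * real DIM('a) * k < m"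
  shows "\<exists>y\<in>cball z \<rho>. u z + k * \<rho>\<^sup>2 \<le> u y"
proof -
  define w where "w y = k * ((y - z) \<bullet> (y - z))" for y
  have cont: "continuous_on \<Omega> u" "continuous_on \<Omega> f" "open \<Omega>" using wl by (auto simp: weak_laplace_def)
  have "continuous_on (cball z \<rho>) (\<lambda>y. u y - w y)"
    unfolding w_def by (intro continuous_intros continuous_on_subset[OF cont(1) \<rho>(2)])
  then obtain y1 where y1: "y1 \<in> cball z \<rho>" "\<And>y. y \<in> cball z \<rho> \<Longrightarrow> u y - w y \<le> u y1 - w y1"
    using continuous_attains_sup[of "cball z \<rho>" "\<lambda>y. u y - w y"] \<rho>(1) by (auto simp: Ball_def)
  have w_eq: "w y = k * (dist z y)\<^sup>2" for y
    by (simp add: w_def dist_norm norm_minus_commute power2_norm_eq_inner[symmetric])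
  have uy1: "u z + k * (dist z y1)\<^sup>2 \<le> u y1" using y1(2)[of z] \<rho>(1) by (simp add: w_eq)
  show ?thesis
  proof (cases "dist z y1 = \<rho>")
    case True then show ?thesis using uy1 y1(1) by auto
  next
    case False
    then have yb: "y1 \<in> ball z \<rho>" using y1(1) by auto
    have "0 \<le> k * (dist z y1)\<^sup>2" using k by simp
    then have "u z \<le> u y1" using uy1 by linarith
    then have fm: "m \<le> f y1" using f y1(1) by blast
    obtain m' where m': "2 * real DIM('a) * k < m'" and m'': "m' < m" using dense[OF km] by blast
    have "isCont f y1" using cont yb \<rho>(2) continuous_on_eq_continuous_at
      by (metis ball_subset_cball subsetD)
    then obtain e where e: "e > 0" "\<And>y. dist y y1 < e \<Longrightarrow> dist (f y) (f y1) < m - m'"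
      using m'' unfolding continuous_at_eps_delta by (metis diff_gt_0_iff_gt)
    obtain d where d: "d > 0" "ball y1 d \<subseteq> ball z \<rho>" using yb by (meson open_ball open_contains_ball)
    define R where "R = min d e / 2"
    have R: "0 < R" "R < d" "R < e" using d e by (auto simp: R_def min_def)
    have Rs: "cball y1 R \<subseteq> cball z \<rho>"
    proof
      fix y assume "y \<in> cball y1 R"
      then have "y \<in> ball y1 d" using R(2) by auto
      then show "y \<in> cball z \<rho>" using d(2) ball_subset_cball by blast
    qed
    have "\<exists>y\<in>cball y1 R. u y1 - w y1 < u y - w y"
    proof (rule no_local_max[OF wl R(1)])
      show "cball y1 R \<subseteq> \<Omega>" using Rs \<rho>(2) by blast
      show "m' \<le> f y" if "y \<in> cball y1 R" for y
        using e(2)[of y] that R(3) fm m'' by (auto simp: dist_real_def dist_commute)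
      show "continuous_on (cball y1 R) w" unfolding w_def by (intro continuous_intros)
      show "((\<lambda>t. w (y + t *\<^sub>R b)) has_real_derivative 2 * k * ((y - z) \<bullet> b)) (at 0)" for y b
        unfolding w_def by (auto intro!: derivative_eq_intros sq_dist_line_deriv)
      show "((\<lambda>t. 2 * k * ((y + t *\<^sub>R b - z) \<bullet> b)) has_real_derivative 2 * k * (b \<bullet> b)) (at 0)" for y b
        by (auto intro!: derivative_eq_intros inner_line_deriv)
      show "(\<Sum>b\<in>(Basis :: 'a set). 2 * k * (b \<bullet> b)) \<le> 2 * real DIM('a) * k" by simp
    qed (rule m')
    then show ?thesis using y1(2) Rs by force
  qed
qed

lemma nearest_frontier_point:
  fixes \<Omega> :: "'a::euclidean_space set"
  assumes "open \<Omega>" "bounded \<Omega>" "x \<in> \<Omega>"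
  obtains q where "q \<in> frontier \<Omega>" "dist x q = bdist \<Omega> x"
proof -
  have ne: "- \<Omega> \<noteq> {}" using assms(2) not_bounded_UNIV by (metis Compl_empty_eq double_complement)
  obtain q where q: "q \<in> - \<Omega>" "infdist x (- \<Omega>) = dist x q"
    using infdist_attains_inf[of "- \<Omega>" x] assms(1) ne by (auto simp: closed_Compl)
  have pos: "0 < dist x q" using q(1) assms(3) by auto
  have "ball x (dist x q) \<subseteq> \<Omega>"
  proof
    fix y assume "y \<in> ball x (dist x q)"
    then show "y \<in> \<Omega>" using infdist_le[of y "- \<Omega>" x] q(2) by (metis ComplI mem_ball not_le)
  qed
  then have "q \<in> closure \<Omega>" using closure_mono[of "ball x (dist x q)" \<Omega>] pos
    by (auto simp: subset_eq)
  then have "q \<in> frontier \<Omega>" using q(1) assms(1) by (auto simp: frontier_def interior_open)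
  then show ?thesis using that q(2) by (simp add: bdist_def)
qed

lemma bdist_pos:
  fixes \<Omega> :: "'a::euclidean_space set"
  assumes "open \<Omega>" "bounded \<Omega>" "x \<in> \<Omega>" shows "0 < bdist \<Omega> x"
proof -
  obtain q where q: "q \<in> frontier \<Omega>" "dist x q = bdist \<Omega> x"
    using nearest_frontier_point[OF assms] .
  then have "x \<noteq> q" using assms by (auto simp: frontier_def interior_open)
  then show ?thesis using q(2) by (metis zero_less_dist_iff)
qed

lemma mem_if_dist_less_bdist: "dist x y < bdist \<Omega> x \<Longrightarrow> y \<in> \<Omega>"
  unfolding bdist_def using infdist_le[of y "- \<Omega>" x] by (metis ComplI not_le)

lemma bdist_lipschitz: "bdist \<Omega> x \<le> bdist \<Omega> y + dist x y"
  unfolding bdist_def by (metis infdist_triangle)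

lemma nonneg_bdist: "0 \<le> bdist \<Omega> x" by (simp add: bdist_def infdist_nonneg)

locale absorption =
  fixes \<Omega> :: "'a::euclidean_space set" and g :: "'a \<Rightarrow> real \<Rightarrow> real" and C1 C2 \<epsilon>0 :: real
  assumes lipschitz: "bounded_lipschitz_domain \<Omega>"
    and g_cont: "continuous_on (\<Omega> \<times> {0..}) (\<lambda>(x, t). g x t)"
    and g_nonneg: "\<And>x t. x \<in> \<Omega> \<Longrightarrow> 0 \<le> t \<Longrightarrow> 0 \<le> g x t"
    and g_zero: "\<And>x. x \<in> \<Omega> \<Longrightarrow> g x 0 = 0"
    and g_mono_on: "\<And>x. x \<in> \<Omega> \<Longrightarrow> mono_on {0..} (g x)"
    and C1: "1 \<le> C1"
    and harnack: "\<And>x x' a. x \<in> \<Omega> \<Longrightarrow> x' \<in> \<Omega> \<Longrightarrow> dist x' x \<le> bdist \<Omega> x / 2 \<Longrightarrow> 0 \<le> a \<Longrightarrow>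
           g x' a \<le> C1 * g x a"
    and C2: "1 \<le> C2" and \<epsilon>0: "0 < \<epsilon>0"
    and KOT: "KOT' \<Omega> g C2"
    and QI: "quasi_inwardly_increasing C2 \<epsilon>0 \<Omega> g"
begin

lemma open_\<Omega>: "open \<Omega>" and bounded_\<Omega>: "bounded \<Omega>"
  using lipschitz by (auto simp: bounded_lipschitz_domain_def)

lemma g_mono: "x \<in> \<Omega> \<Longrightarrow> 0 \<le> s \<Longrightarrow> s \<le> t \<Longrightarrow> g x s \<le> g x t"
  using g_mono_on[of x] unfolding mono_on_def by auto

lemma KO_g:
  assumes "x \<in> \<Omega>" shows "KO_fun C2 (g x)"
proof -
  have "continuous_on {0..} (\<lambda>t. (\<lambda>(x, t). g x t) (x, t))"
    by (rule continuous_on_compose2[OF g_cont]) (use assms in \<open>auto intro!: continuous_intros\<close>)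
  then show ?thesis
    using assms C2 g_mono_on g_nonneg KOT unfolding KO_fun_def KOT'_def primitive_def by auto
qed

lemma solutionD:
  assumes "nonneg_solution \<Omega> g u"
  shows "weak_laplace \<Omega> u (\<lambda>x. g x (u x))" "continuous_on \<Omega> u" "\<And>x. x \<in> \<Omega> \<Longrightarrow> 0 \<le> u x"
proof -
  show u: "continuous_on \<Omega> u" "\<And>x. x \<in> \<Omega> \<Longrightarrow> 0 \<le> u x"
    using assms by (auto simp: nonneg_solution_def)
  have "continuous_on \<Omega> (\<lambda>x. (\<lambda>(x, t). g x t) (x, u x))"
    by (rule continuous_on_compose2[OF g_cont]) (use u in \<open>auto intro!: continuous_intros\<close>)
  then show "weak_laplace \<Omega> u (\<lambda>x. g x (u x))"
    using assms open_\<Omega> by (auto simp: nonneg_solution_def weak_laplace_def)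
qed

lemma diameter_bound:
  "\<exists>D\<ge>1. (\<forall>x\<in>closure \<Omega>. \<forall>y\<in>closure \<Omega>. dist x y \<le> D) \<and> (\<forall>x\<in>\<Omega>. bdist \<Omega> x \<le> D)"
proof -
  obtain D where D: "\<forall>x\<in>closure \<Omega>. \<forall>y\<in>closure \<Omega>. dist x y \<le> D"
    using bounded_\<Omega> bounded_two_points[of "closure \<Omega>"] by auto
  have "bdist \<Omega> x \<le> D" if x: "x \<in> \<Omega>" for x
  proof -
    obtain q where "q \<in> frontier \<Omega>" "dist x q = bdist \<Omega> x"
      using nearest_frontier_point[OF open_\<Omega> bounded_\<Omega> x] .
    moreover have "x \<in> closure \<Omega>" using x closure_subset by blast
    ultimately show ?thesis using D by (metis Diff_iff frontier_def)
  qed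
  then show ?thesis using D by (intro exI[of _ "max 1 D"]) (simp add: le_max_iff_disj)
qed

text \<open>Let \<open>z\<close> be the weighted maximum in the ball of radius \<open>R = \<delta> / 4\<close>, with \<open>t = u z\<close> and
  \<open>s = R - dist z x\<close>. Since \<open>u \<le> 2 ^ p * t\<close> on the ball of radius \<open>s / 2\<close> about \<open>z\<close>,
  \<open>quadratic_growth\<close> gives \<open>g x t \<le> const * t / s\<^sup>2\<close>. On the other hand \<open>t \<ge> a * (R / s) ^ p\<close>, and
  \<open>KO_growth\<close> gives \<open>g x t / t \<ge> const * (R / s)\<^sup>2 * g x a / a\<close>. The factors \<open>s\<^sup>2\<close> cancel.\<close>

lemma interior_estimate:
  "\<exists>c0>0. \<forall>u. nonneg_solution \<Omega> g u \<longrightarrow> (\<forall>x\<in>\<Omega>. g x (u x) * (bdist \<Omega> x)\<^sup>2 \<le> c0 * u x)"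
proof -
  obtain p where p: "0 < p" "\<And>h a X t. KO_fun C2 h \<Longrightarrow> 0 < a \<Longrightarrow> 8 * C2 ^ 3 * a \<le> h a \<Longrightarrow> 1 \<le> X \<Longrightarrow>
    a * X ^ p \<le> t \<Longrightarrow> X\<^sup>2 * h a * t \<le> 32 * C2\<^sup>2 * h t * a" using KO_growth[of C2] by auto
  obtain D where D: "1 \<le> D" "\<And>x. x \<in> \<Omega> \<Longrightarrow> bdist \<Omega> x \<le> D" using diameter_bound by auto
  define N where "N = real DIM('a)"
  have N: "1 \<le> N" unfolding N_def using DIM_positive[where 'a='a] by linarith
  define c where "c = 8192 * 2 ^ p * C2\<^sup>2 * N * C1"
  have cpos: "0 < c" using N C1 C2 by (simp add: c_def)
  have cl: "g x (u x) * (bdist \<Omega> x)\<^sup>2 \<le> (c + 8 * C2 ^ 3 * D\<^sup>2) * u x"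
    if sol: "nonneg_solution \<Omega> g u" and x: "x \<in> \<Omega>" for u x
  proof -
    note u = solutionD[OF sol]
    define \<delta> where "\<delta> = bdist \<Omega> x"
    have \<delta>: "0 < \<delta>" "\<delta> \<le> D" unfolding \<delta>_def using bdist_pos[OF open_\<Omega> bounded_\<Omega> x] D x by auto
    define a where "a = u x"
    have sum: "g x a * \<delta>\<^sup>2 \<le> c * a \<or> g x a * \<delta>\<^sup>2 \<le> 8 * C2 ^ 3 * D\<^sup>2 * a"
    proof -
      consider "a = 0" | "0 < a" "g x a < 8 * C2 ^ 3 * a" | "0 < a" "8 * C2 ^ 3 * a \<le> g x a"
        using u(3)[OF x] unfolding a_def by linarith
      then show ?thesis
      proof cases
        case 1 then show ?thesis using g_zero[OF x] by simp
      next
        case 2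
        have "g x a * \<delta>\<^sup>2 \<le> (8 * C2 ^ 3 * a) * D\<^sup>2"
          using 2 \<delta> C2 by (intro mult_mono power_mono) auto
        then show ?thesis by (simp add: mult_ac)
      next
        case 3
        define R where "R = \<delta> / 4"
        have R: "0 < R" using \<delta> by (simp add: R_def)
        have inO: "y \<in> \<Omega>" if "dist y x \<le> R" for y
          using that \<delta> mem_if_dist_less_bdist[of x y \<Omega>] by (auto simp: R_def \<delta>_def[symmetric] dist_commute)
        have gx: "g x t \<le> C1 * g y t" if "dist y x \<le> R" "0 \<le> t" for y t
        proof (rule harnack)
          have "\<delta> \<le> bdist \<Omega> y + dist y x"
            using bdist_lipschitz[of \<Omega> x y] by (simp add: \<delta>_def dist_commute)
          then show "dist x y \<le> bdist \<Omega> y / 2"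
            using that(1) zero_le_dist[of y x] unfolding R_def dist_commute[of x y] by linarith
        qed (use that inO x in auto)
        have van: "vanishes_on \<Omega> (frontier \<Omega> \<inter> cball x R) u"
          using inO open_\<Omega> by (auto simp: vanishes_on_def frontier_def interior_open dist_commute)
        obtain z where z: "z \<in> \<Omega>" "dist z x < R" "0 < u z"
          "\<And>y. y \<in> \<Omega> \<Longrightarrow> dist y x \<le> R \<Longrightarrow> u y * (R - dist y x) ^ p \<le> u z * (R - dist z x) ^ p"
          using weighted_max[OF open_\<Omega> u(2) van x _ R p(1)] 3(1) unfolding a_def by blast
        define t where "t = u z"
        define s where "s = R - dist z x"
        have s: "0 < s" "s \<le> R" using z(2) by (auto simp: s_def)
        have t: "0 < t" using z(3) by (simp add: t_def)
        have "a * (R / s) ^ p \<le> t"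
          using z(4)[OF x] R s by (simp add: a_def t_def s_def[symmetric] power_divide field_simps)
        then have gr: "(R / s)\<^sup>2 * g x a * t \<le> 32 * C2\<^sup>2 * g x t * a"
          using p(2)[OF KO_g[OF x] 3, of "R / s" t] s by simp
        have gpos: "0 < g x a" using 3 C2 by (smt (verit) mult_pos_pos zero_less_power)
        have "0 < (R / s)\<^sup>2 * g x a * t" using R s t gpos by simp
        then have "0 < (32 * C2\<^sup>2 * a) * g x t" using gr by (simp add: mult_ac)
        moreover have "0 < 32 * C2\<^sup>2 * a" using C2 3 by simp
        ultimately have gt: "0 < g x t" by (rule zero_less_mult_pos)
        have near: "y \<in> \<Omega>" "dist y x \<le> R" "u y \<le> 2 ^ p * t" if y: "y \<in> cball z (s / 2)" for y
        proof -
          have h: "s / 2 \<le> R - dist y x"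
            using dist_triangle[of y x z] y by (simp add: s_def dist_commute field_simps)
          then show y1: "dist y x \<le> R" using s by simp
          then show y2: "y \<in> \<Omega>" by (rule inO)
          have "u y * (s / 2) ^ p \<le> u y * (R - dist y x) ^ p"
            using h s u(3)[OF y2] by (intro mult_left_mono power_mono) auto
          also have "\<dots> \<le> t * s ^ p" using z(4)[OF y2 y1] by (simp add: t_def s_def)
          finally show "u y \<le> 2 ^ p * t" using s by (simp add: power_divide field_simps)
        qed
        define k where "k = g x t / (4 * N * C1)"
        have k: "0 < k" using gt N C1 by (simp add: k_def)
        have "\<exists>y\<in>cball z (s / 2). u z + k * (s / 2)\<^sup>2 \<le> u y"
        proof (rule quadratic_growth[OF u(1) _ _ k])
          show "g x t / C1 \<le> g y (u y)" if "y \<in> cball z (s / 2)" "u z \<le> u y" for y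
          proof -
            have "g x t \<le> C1 * g y t" using gx near that(1) t by simp
            also have "\<dots> \<le> C1 * g y (u y)"
              using g_mono[of y t "u y"] near that t C1 by (intro mult_left_mono) (auto simp: t_def)
            finally show ?thesis using C1 by (simp add: field_simps)
          qed
          show "2 * real DIM('a) * k < g x t / C1" using gt N C1 by (simp add: k_def N_def[symmetric] field_simps)
        qed (use s near in auto)
        then obtain y where "y \<in> cball z (s / 2)" "t + k * (s / 2)\<^sup>2 \<le> u y" by (auto simp: t_def)
        then have "k * (s / 2)\<^sup>2 \<le> 2 ^ p * t" using near(3) t by fastforce
        then have ks: "g x t * s\<^sup>2 \<le> 16 * N * C1 * 2 ^ p * t"
          using N C1 by (simp add: k_def power_divide field_simps)
        have "(R\<^sup>2 * g x a) * t = ((R / s)\<^sup>2 * g x a * t) * s\<^sup>2" using s by (simp add: power_divide)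
        also have "\<dots> \<le> (32 * C2\<^sup>2 * g x t * a) * s\<^sup>2" using gr by (intro mult_right_mono) auto
        also have "\<dots> = (32 * C2\<^sup>2 * a) * (g x t * s\<^sup>2)" by simp
        also have "\<dots> \<le> (32 * C2\<^sup>2 * a) * (16 * N * C1 * 2 ^ p * t)"
          using 3 by (intro mult_left_mono ks) auto
        also have "\<dots> = (c * a / 16) * t" by (simp add: c_def)
        finally have "R\<^sup>2 * g x a \<le> c * a / 16" using t by simp
        then show ?thesis by (simp add: R_def power_divide mult.commute)
      qed
    qed
    have "0 \<le> a" using u(3)[OF x] by (simp add: a_def)
    then have "0 \<le> c * a" "0 \<le> 8 * C2 ^ 3 * D\<^sup>2 * a" using cpos C2 by auto
    then show ?thesis using sum unfolding a_def[symmetric] \<delta>_def[symmetric]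
      by (simp only: distrib_right) linarith
  qed
  have "0 < c + 8 * C2 ^ 3 * D\<^sup>2" using cpos C2 by (simp add: add_pos_nonneg)
  then show ?thesis using cl by blast
qed

end

section \<open>Geometry of Lipschitz domains\<close>


text \<open>A function \<open>h\<close> that measures the signed height above the boundary graph. It retains from the
  representation \<open>h x = x \<bullet> e - \<psi> (x - (x \<bullet> e) *\<^sub>R e)\<close> only what is used: unit growth in the direction \<open>e\<close>
  and a Lipschitz bound.\<close>

definition chart :: "'a::euclidean_space set \<Rightarrow> 'a \<Rightarrow> real \<Rightarrow> real \<Rightarrow> 'a \<Rightarrow> ('a \<Rightarrow> real) \<Rightarrow> bool"
  where "chart \<Omega> p \<rho> M e h \<longleftrightarrow> norm e = 1 \<and> (\<forall>x s. h (x + s *\<^sub>R e) = h x + s) \<and>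
    (\<forall>x y. \<bar>h x - h y\<bar> \<le> M * dist x y) \<and> (\<forall>x\<in>ball p \<rho>. x \<in> \<Omega> \<longleftrightarrow> 0 < h x)"

lemma chart_mono:
  "chart \<Omega> p \<rho> M e h \<Longrightarrow> ball p' \<rho>' \<subseteq> ball p \<rho> \<Longrightarrow> M \<le> M' \<Longrightarrow> chart \<Omega> p' \<rho>' M' e h"
  unfolding chart_def by (meson mult_right_mono order_trans subsetD zero_le_dist)

lemma norm_projection_le:
  assumes "norm e = 1" shows "norm (v - (v \<bullet> e) *\<^sub>R e) \<le> norm v"
proof -
  have "e \<bullet> e = 1" using assms by (simp add: norm_eq_1)
  then have "(v - (v \<bullet> e) *\<^sub>R e) \<bullet> (v - (v \<bullet> e) *\<^sub>R e) = v \<bullet> v - (v \<bullet> e)\<^sup>2"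
    by (simp add: inner_diff_left inner_diff_right inner_commute power2_eq_square)
  then show ?thesis by (simp add: norm_le)
qed

lemma uniform_charts:
  fixes \<Omega> :: "'a::euclidean_space set"
  assumes "bounded_lipschitz_domain \<Omega>"
  shows "\<exists>\<rho>>0. \<exists>M\<ge>1. \<forall>p\<in>frontier \<Omega>. \<exists>e h. chart \<Omega> p \<rho> M e h"
proof -
  have "\<exists>\<rho> M. 0 < \<rho> \<and> 1 \<le> M \<and> (\<exists>e h. chart \<Omega> p (2 * \<rho>) M e h)" if p: "p \<in> frontier \<Omega>" for p
  proof -
    obtain U e \<psi> L where U: "open U" "p \<in> U" and e: "norm e = 1"
      and \<psi>: "L-lipschitz_on {y. y \<bullet> e = 0} (\<psi> :: 'a \<Rightarrow> real)"
      and epi: "\<forall>x\<in>U. x \<in> \<Omega> \<longleftrightarrow> \<psi> (x - (x \<bullet> e) *\<^sub>R e) < x \<bullet> e"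
      using assms p unfolding bounded_lipschitz_domain_def by metis
    obtain \<rho> where \<rho>: "0 < \<rho>" "ball p \<rho> \<subseteq> U" using U openE by blast
    have ee: "e \<bullet> e = 1" using e by (simp add: norm_eq_1)
    define h where "h x = x \<bullet> e - \<psi> (x - (x \<bullet> e) *\<^sub>R e)" for x
    have "\<bar>h x - h y\<bar> \<le> (1 + L) * dist x y" for x y
    proof -
      have "\<bar>x \<bullet> e - y \<bullet> e\<bar> \<le> dist x y"
        using Cauchy_Schwarz_ineq2[of "x - y" e] e by (simp add: inner_diff_left dist_norm)
      moreover have "\<bar>\<psi> (x - (x \<bullet> e) *\<^sub>R e) - \<psi> (y - (y \<bullet> e) *\<^sub>R e)\<bar>
          \<le> L * dist (x - (x \<bullet> e) *\<^sub>R e) (y - (y \<bullet> e) *\<^sub>R e)"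
        using lipschitz_onD[OF \<psi>] by (auto simp: dist_real_def inner_diff_left ee)
      moreover have "L * dist (x - (x \<bullet> e) *\<^sub>R e) (y - (y \<bullet> e) *\<^sub>R e) \<le> L * dist x y"
        using norm_projection_le[OF e, of "x - y"] lipschitz_on_nonneg[OF \<psi>]
        by (intro mult_left_mono) (auto simp: dist_norm inner_diff_left scaleR_diff_left algebra_simps)
      ultimately show ?thesis unfolding h_def by (simp add: algebra_simps)
    qed
    moreover have "h (x + s *\<^sub>R e) = h x + s" for x s
      by (simp add: h_def inner_add_left ee scaleR_add_left algebra_simps)
    ultimately have "chart \<Omega> p (2 * (\<rho> / 2)) (1 + L) e h"
      using e \<rho> epi unfolding chart_def h_def by auto
    then show ?thesis using \<rho>(1) lipschitz_on_nonneg[OF \<psi>]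
      by (intro exI[of _ "\<rho> / 2"] exI[of _ "1 + L"]) auto
  qed
  then obtain \<rho> M where
    \<rho>M: "\<And>p. p \<in> frontier \<Omega> \<Longrightarrow> 0 < \<rho> p \<and> 1 \<le> M p \<and> (\<exists>e h. chart \<Omega> p (2 * \<rho> p) (M p) e h)"
    by metis
  have "compact (frontier \<Omega>)"
    using assms by (simp add: bounded_lipschitz_domain_def compact_frontier_bounded)
  then obtain T where T: "T \<subseteq> frontier \<Omega>" "finite T" "frontier \<Omega> \<subseteq> (\<Union>p\<in>T. ball p (\<rho> p))"
    using \<rho>M by (elim compactE_image[of _ "frontier \<Omega>" "\<lambda>p. ball p (\<rho> p)"]) force+
  define \<rho>' where "\<rho>' = Min (insert 1 (\<rho> ` T))"
  define M' where "M' = Max (insert 1 (M ` T))"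
  have "0 < \<rho>'" unfolding \<rho>'_def using T \<rho>M by (subst Min_gr_iff) auto
  moreover have "1 \<le> M'" unfolding M'_def using T by (intro Max_ge) auto
  moreover have "\<exists>e h. chart \<Omega> p \<rho>' M' e h" if pf: "p \<in> frontier \<Omega>" for p
  proof -
    obtain q where q: "q \<in> T" "p \<in> ball q (\<rho> q)" using T(3) pf by blast
    obtain e h where c: "chart \<Omega> q (2 * \<rho> q) (M q) e h" using \<rho>M q(1) T(1) by blast
    have "\<rho>' \<le> \<rho> q" "M q \<le> M'" using q(1) T(2) by (auto simp: \<rho>'_def M'_def)
    moreover have "ball p \<rho>' \<subseteq> ball q (2 * \<rho> q)"
    proof
      fix x assume "x \<in> ball p \<rho>'"
      then show "x \<in> ball q (2 * \<rho> q)"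
        using q(2) \<open>\<rho>' \<le> \<rho> q\<close> dist_triangle[of q x p] by auto
    qed
    ultimately show ?thesis using chart_mono[OF c] by blast
  qed
  ultimately show ?thesis by blast
qed

lemma chart_frontier_zero:
  fixes \<Omega> :: "'a::euclidean_space set"
  assumes c: "chart \<Omega> p \<rho> M e h" and "0 < \<rho>" "1 \<le> M" "open \<Omega>" and p: "p \<in> frontier \<Omega>"
  shows "h p = 0"
proof (rule antisym)
  have "p \<notin> \<Omega>" "p \<in> closure \<Omega>" using p assms(4) by (auto simp: frontier_def interior_open)
  then show "h p \<le> 0" using c \<open>0 < \<rho>\<close> by (auto simp: chart_def not_less)
  show "0 \<le> h p"
  proof (rule ccontr)
    assume "\<not> 0 \<le> h p"
    then have "0 < min \<rho> (- h p / M)" using assms(2,3) by (simp add: divide_neg_pos)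
    then obtain x where x: "x \<in> \<Omega>" "dist x p < min \<rho> (- h p / M)"
      using \<open>p \<in> closure \<Omega>\<close> unfolding closure_approachable by blast
    then have "0 < h x" using c by (auto simp: chart_def dist_commute)
    moreover have "\<bar>h x - h p\<bar> \<le> M * dist x p" using c by (auto simp: chart_def)
    moreover have "M * dist x p < - h p" using x(2) assms(3) by (simp add: field_simps)
    ultimately show False by linarith
  qed
qed

text \<open>The centre \<open>q\<close> lies at height \<open>- \<rho> / 8\<close> below \<open>p\<close>; a ball whose radius is smaller by the Lipschitz constant
  stays at negative height.\<close>

lemma exterior_balls:
  fixes \<Omega> :: "'a::euclidean_space set"
  assumes "bounded_lipschitz_domain \<Omega>"
  shows "\<exists>\<rho>0>0. \<exists>\<kappa>>0. \<kappa> \<le> 1/8 \<and> (\<forall>p\<in>frontier \<Omega>. \<forall>\<rho>. 0 < \<rho> \<and> \<rho> \<le> \<rho>0 \<longrightarrow>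
    (\<exists>q. dist p q = \<rho> / 8 \<and> ball q (\<kappa> * \<rho>) \<inter> \<Omega> = {}))"
proof -
  obtain \<rho>0 M where \<rho>0: "0 < \<rho>0" and M: "1 \<le> M"
    and ch: "\<And>p. p \<in> frontier \<Omega> \<Longrightarrow> \<exists>e h. chart \<Omega> p \<rho>0 M e h"
    using uniform_charts[OF assms] by blast
  have "\<exists>q. dist p q = \<rho> / 8 \<and> ball q (1 / (8 * M) * \<rho>) \<inter> \<Omega> = {}"
    if p: "p \<in> frontier \<Omega>" and \<rho>: "0 < \<rho>" "\<rho> \<le> \<rho>0" for p \<rho>
  proof -
    obtain e h where c: "chart \<Omega> p \<rho>0 M e h" using ch[OF p] by blast
    have hp: "h p = 0" using chart_frontier_zero[OF c \<rho>0 M _ p] assms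
      by (simp add: bounded_lipschitz_domain_def)
    define q where "q = p + (- \<rho> / 8) *\<^sub>R e"
    have hq: "h q = - \<rho> / 8" using c hp unfolding chart_def q_def by (metis add_0)
    have pq: "dist p q = \<rho> / 8" using c \<rho> by (simp add: q_def dist_norm chart_def)
    have "x \<notin> \<Omega>" if x: "x \<in> ball q (1 / (8 * M) * \<rho>)" for x
    proof -
      have "dist q x < \<rho> / (8 * M)" using x by simp
      moreover have "\<rho> / (8 * M) \<le> \<rho> / 8" using M \<rho> by (simp add: field_simps)
      ultimately have px: "dist p x < \<rho>0" using dist_triangle[of p x q] pq \<rho> by linarith
      have "M * dist q x < \<rho> / 8" using \<open>dist q x < \<rho> / (8 * M)\<close> M by (simp add: field_simps)
      moreover have "\<bar>h x - h q\<bar> \<le> M * dist q x" using c unfolding chart_def by (metis dist_commute)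
      ultimately have "h x < 0" using hq by linarith
      then show ?thesis using c px by (auto simp: chart_def)
    qed
    then show ?thesis using pq by (intro exI[of _ q]) auto
  qed
  then show ?thesis using \<rho>0 M
    by (intro exI[of _ \<rho>0] conjI exI[of _ "1 / (8 * M)"]) auto
qed

text \<open>The least number of steps of ratio \<open>q\<close> needed to reach the ratio \<open>X\<close>, together with the resulting
  polynomial cost when each step costs a factor \<open>C\<close>.\<close>

lemma geometric_step_count:
  fixes q C X :: real
  assumes "1 < q" "1 \<le> C" "C \<le> q ^ \<beta>" "1 \<le> X"
  obtains n where "X \<le> q ^ n" "C ^ n \<le> C * X ^ \<beta>"
proof -
  obtain N where "X \<le> q ^ N" using real_arch_pow[OF assms(1), of X] less_imp_le by blast
  define n where "n = (LEAST n. X \<le> q ^ n)"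
  have n: "X \<le> q ^ n" unfolding n_def by (rule LeastI) fact
  have "C ^ n \<le> C * X ^ \<beta>"
  proof (cases n)
    case 0
    have "1 * 1 \<le> C * X ^ \<beta>" using assms by (intro mult_mono) auto
    then show ?thesis using 0 by simp
  next
    case (Suc m)
    have "\<not> X \<le> q ^ m" using not_less_Least[of m "\<lambda>n. X \<le> q ^ n"] Suc n_def by simp
    then have m: "q ^ m \<le> X" by simp
    have "C ^ m \<le> (q ^ \<beta>) ^ m" using assms by (intro power_mono) auto
    also have "\<dots> = (q ^ m) ^ \<beta>" by (simp add: mult.commute flip: power_mult)
    also have "\<dots> \<le> X ^ \<beta>" using m assms(1) by (intro power_mono) auto
    finally show ?thesis using Suc assms(2) by simp
  qed
  then show ?thesis using that n by blast
qed

context absorption begin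

lemma vertical_depth:
  assumes c: "chart \<Omega> p \<rho> M e h" and \<rho>: "0 < \<rho>" and M: "1 \<le> M" and p: "p \<in> frontier \<Omega>"
    and z: "z \<in> \<Omega>" and s: "0 \<le> s" "dist p z + s < \<rho> / 2"
  shows "z + s *\<^sub>R e \<in> \<Omega>" "h z + s \<le> M * bdist \<Omega> (z + s *\<^sub>R e)"
proof -
  have e: "norm e = 1" "\<And>x s. h (x + s *\<^sub>R e) = h x + s" using c by (auto simp: chart_def)
  have hp: "h p = 0" by (rule chart_frontier_zero[OF c \<rho> M open_\<Omega> p])
  have in_iff: "y \<in> \<Omega> \<longleftrightarrow> 0 < h y" if "dist p y < \<rho>" for y using c that by (auto simp: chart_def)
  have lip: "\<bar>h x - h y\<bar> \<le> M * dist x y" for x y using c by (auto simp: chart_def)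
  define y where "y = z + s *\<^sub>R e"
  have hy: "h y = h z + s" using e(2) by (simp add: y_def)
  have "dist p y \<le> dist p z + s"
    using dist_triangle[of p y z] e(1) s by (simp add: dist_norm y_def)
  then have d: "dist p y < \<rho> / 2" using s by linarith
  have "dist p z < \<rho>" using s \<rho> by linarith
  then have "0 < h z" using in_iff[of z] z by blast
  then have y: "y \<in> \<Omega>" using in_iff[of y] hy s d \<rho> by auto
  then show "z + s *\<^sub>R e \<in> \<Omega>" by (simp add: y_def)
  obtain q where q: "q \<in> frontier \<Omega>" "dist y q = bdist \<Omega> y"
    using nearest_frontier_point[OF open_\<Omega> bounded_\<Omega> y] .
  have "h y \<le> M * bdist \<Omega> y"
  proof (cases "dist p q < \<rho>")
    case True
    then have "h q \<le> 0" using in_iff[of q] q(1) open_\<Omega> by (auto simp: frontier_def interior_open not_less)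
    then show ?thesis using lip[of y q] q(2) by simp
  next
    case False
    then have "dist p y \<le> dist y q" using d dist_triangle[of p q y] by linarith
    then have "M * dist p y \<le> M * bdist \<Omega> y" using M q(2) by (intro mult_left_mono) auto
    then show ?thesis using lip[of y p] hp by (simp add: dist_commute)
  qed
  then show "h z + s \<le> M * bdist \<Omega> (z + s *\<^sub>R e)" using hy by (simp add: y_def)
qed

text \<open>Height is comparable to depth, so multiplying the height by \<open>1 + 1 / (2 * M)\<close> moves a point by at most half
  its distance to the boundary, and costs one application of the comparability of \<open>g\<close> in either
  direction.\<close>

lemma vertical_chain:
  assumes c: "chart \<Omega> p \<rho> M e h" and \<rho>: "0 < \<rho>" and M: "1 \<le> M" and p: "p \<in> frontier \<Omega>"
    and z: "z \<in> \<Omega>" and t: "0 \<le> t"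
    and s: "0 \<le> s" "dist p z + s < \<rho> / 2" "h z + s \<le> h z * (1 + 1 / (2 * M)) ^ n"
  shows "g (z + s *\<^sub>R e) t \<le> C1 ^ n * g z t \<and> g z t \<le> C1 ^ n * g (z + s *\<^sub>R e) t"
  using s
proof (induction n arbitrary: s)
  case 0
  have "dist p z < \<rho>" using 0 \<rho> by linarith
  then have "0 < h z" using c z by (auto simp: chart_def)
  then have "s = 0" using 0 by simp
  then show ?case by simp
next
  case (Suc n)
  note IH = Suc.IH and s = Suc.prems
  have e: "norm e = 1" "\<And>x s. h (x + s *\<^sub>R e) = h x + s" using c by (auto simp: chart_def)
  define q where "q = 1 + 1 / (2 * M)"
  have q: "1 < q" using M by (simp add: q_def)
  have "dist p z < \<rho>" using s(1,2) \<rho> by linarith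
  then have hz: "0 < h z" using c z by (auto simp: chart_def)
  define s' where "s' = max 0 ((h z + s) / q - h z)"
  have s'0: "0 \<le> s'" by (simp add: s'_def)
  have "(h z + s) / q \<le> (h z + s) / 1" using q hz s(1) by (intro divide_left_mono) auto
  then have s's: "s' \<le> s" using s(1) by (simp add: s'_def)
  have "(h z + s) / q \<le> h z * q ^ n" using s(3)[folded q_def] q by (simp add: field_simps)
  moreover have "h z * 1 \<le> h z * q ^ n" using hz q by (intro mult_left_mono) auto
  ultimately have I0: "h z + s' \<le> h z * q ^ n" by (simp add: s'_def max_def)
  define y where "y = z + s' *\<^sub>R e"
  define x where "x = z + s *\<^sub>R e"
  have IHy: "g y t \<le> C1 ^ n * g z t" "g z t \<le> C1 ^ n * g y t"
    using IH[OF s'0 _ I0[unfolded q_def]] s s's by (auto simp: y_def)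
  have y: "y \<in> \<Omega>" "h z + s' \<le> M * bdist \<Omega> y"
    unfolding y_def using s s's by (intro vertical_depth[OF c \<rho> M p z s'0]; simp)+
  have x: "x \<in> \<Omega>" "h z + s \<le> M * bdist \<Omega> x"
    unfolding x_def using s by (intro vertical_depth[OF c \<rho> M p z s(1,2)])+
  have "(h z + s) / q \<le> h z + s'" by (simp add: s'_def)
  then have "h z + s \<le> q * (h z + s')" using q by (simp add: field_simps)
  then have "s - s' \<le> (h z + s') / (2 * M)" by (simp add: q_def algebra_simps)
  then have st: "2 * M * (s - s') \<le> h z + s'" using M by (simp add: field_simps)
  have dxy: "dist x y = s - s'"
    using e(1) s's by (simp add: x_def y_def dist_norm scaleR_diff_left[symmetric])
  have "M * (2 * (s - s')) \<le> M * bdist \<Omega> y" using st y(2) by (simp only: mult_ac)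
  then have dy: "dist x y \<le> bdist \<Omega> y / 2" using M dxy by simp
  have "M * (2 * (s - s')) \<le> M * bdist \<Omega> x" using st x(2) s's by (simp only: mult_ac)
  then have dx: "dist y x \<le> bdist \<Omega> x / 2" using M dxy by (simp add: dist_commute)
  have "g x t \<le> C1 * g y t" by (rule harnack[OF y(1) x(1) dy t])
  also have "\<dots> \<le> C1 * (C1 ^ n * g z t)" using IHy(1) C1 by (intro mult_left_mono) auto
  finally have 1: "g x t \<le> C1 ^ Suc n * g z t" by simp
  have "C1 ^ n * g y t \<le> C1 ^ n * (C1 * g x t)"
    using harnack[OF x(1) y(1) dx t] C1 by (intro mult_left_mono) auto
  then have 2: "g z t \<le> C1 ^ Suc n * g x t" using IHy(2) by (simp add: mult_ac)
  show ?case using 1 2 by (simp add: x_def)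
qed

text \<open>From \<open>x\<close> and from \<open>y\<close> climb vertically by \<open>R\<close>. The factor 12 in \<open>R = 12 * M * r\<close> makes the two upper points
  so deep that their distance, below \<open>6 * r\<close>, is at most half their depth: one comparison joins them.\<close>

lemma boundary_chain:
  "\<exists>\<rho>>0. \<exists>\<beta> B. 0 < B \<and> (\<forall>p\<in>frontier \<Omega>. \<forall>r x y t. 0 < r \<and> r \<le> \<rho> \<and> x \<in> \<Omega> \<and> y \<in> \<Omega> \<and>
     dist p x < 3 * r \<and> dist p y < 3 * r \<and> 0 \<le> t \<longrightarrow>
     g x t \<le> B * (r / bdist \<Omega> x) ^ \<beta> * (r / bdist \<Omega> y) ^ \<beta> * g y t)"
proof -
  obtain \<rho>0 M where \<rho>0: "0 < \<rho>0" and M: "1 \<le> M"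
    and ch: "\<And>p. p \<in> frontier \<Omega> \<Longrightarrow> \<exists>e h. chart \<Omega> p \<rho>0 M e h"
    using uniform_charts[OF lipschitz] by blast
  define q where "q = 1 + 1 / (2 * M)"
  have q: "1 < q" using M by (simp add: q_def)
  obtain \<beta> where \<beta>: "C1 \<le> q ^ \<beta>" using real_arch_pow[OF q, of C1] less_imp_le by blast
  define B where "B = C1 ^ 3 * (15 * M) ^ \<beta> * (15 * M) ^ \<beta>"
  have main: "g x t \<le> B * (r / bdist \<Omega> x) ^ \<beta> * (r / bdist \<Omega> y) ^ \<beta> * g y t"
    if p: "p \<in> frontier \<Omega>" and r: "0 < r" "r \<le> \<rho>0 / (31 * M)"
      and x: "x \<in> \<Omega>" "dist p x < 3 * r" and y: "y \<in> \<Omega>" "dist p y < 3 * r" and t: "0 \<le> t"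
    for p r x y t
  proof -
    obtain e h where c: "chart \<Omega> p \<rho>0 M e h" using ch[OF p] by blast
    have hp: "h p = 0" by (rule chart_frontier_zero[OF c \<rho>0 M open_\<Omega> p])
    define R where "R = 12 * M * r"
    have rM: "r \<le> M * r" using M r by simp
    have R: "0 < R" using M r by (simp add: R_def)
    have Mr: "31 * (M * r) \<le> \<rho>0" using r M by (simp add: field_simps)
    have factor: "g (z + R *\<^sub>R e) t \<le> C1 * (15 * M) ^ \<beta> * (r / bdist \<Omega> z) ^ \<beta> * g z t"
        "g z t \<le> C1 * (15 * M) ^ \<beta> * (r / bdist \<Omega> z) ^ \<beta> * g (z + R *\<^sub>R e) t"
        "z + R *\<^sub>R e \<in> \<Omega>" "12 * r \<le> bdist \<Omega> (z + R *\<^sub>R e)"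
      if z: "z \<in> \<Omega>" "dist p z < 3 * r" for z
    proof -
      have d: "dist p z + R < \<rho>0 / 2" using z(2) Mr rM R by (simp add: R_def)
      have dz: "dist p z < \<rho>0" using z(2) Mr rM R by (simp add: R_def)
      have hz: "0 < h z" using c z dz by (auto simp: chart_def)
      have "\<bar>h z - h p\<bar> \<le> M * dist z p" using c by (auto simp: chart_def)
      also have "\<dots> \<le> M * (3 * r)" using z(2) M by (intro mult_left_mono) (auto simp: dist_commute)
      finally have hz3: "h z \<le> 3 * (M * r)" using hp by simp
      have bd: "bdist \<Omega> z \<le> h z"
      proof -
        define w where "w = z + (- h z) *\<^sub>R e"
        have "h w = 0" using c unfolding chart_def w_def by (metis add.right_inverse)
        have zw: "dist z w = h z" using c hz by (simp add: w_def dist_norm chart_def)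
        have "dist p w < \<rho>0" using dist_triangle[of p w z] zw hz3 z(2) Mr rM R by (simp add: R_def)
        then have "w \<notin> \<Omega>" using c \<open>h w = 0\<close> by (auto simp: chart_def)
        then show ?thesis using infdist_le[of w "- \<Omega>" z] zw by (simp add: bdist_def)
      qed
      have bp: "0 < bdist \<Omega> z" by (rule bdist_pos[OF open_\<Omega> bounded_\<Omega> z(1)])
      define X where "X = 15 * M * (r / bdist \<Omega> z)"
      have "(h z + R) / h z \<le> 15 * (M * r) / bdist \<Omega> z"
        using hz3 hz R bd bp by (intro frac_le) (auto simp: R_def)
      then have X: "(h z + R) / h z \<le> X" by (simp add: X_def)
      have "1 \<le> (h z + R) / h z" using hz R by (simp add: field_simps)
      then have "1 \<le> X" using X by linarith
      then obtain n where n: "X \<le> q ^ n" "C1 ^ n \<le> C1 * X ^ \<beta>"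
        using geometric_step_count[OF q C1 \<beta>] by blast
      have "h z + R \<le> h z * X" using X hz by (simp add: field_simps)
      also have "\<dots> \<le> h z * q ^ n" using n(1) hz by (intro mult_left_mono) auto
      finally have "h z + R \<le> h z * q ^ n" .
      then have vc: "g (z + R *\<^sub>R e) t \<le> C1 ^ n * g z t" "g z t \<le> C1 ^ n * g (z + R *\<^sub>R e) t"
        using vertical_chain[OF c \<rho>0 M p z(1) t _ d] R by (auto simp: q_def)
      show top: "z + R *\<^sub>R e \<in> \<Omega>" using vertical_depth(1)[OF c \<rho>0 M p z(1) _ d] R by simp
      have "R \<le> M * bdist \<Omega> (z + R *\<^sub>R e)"
        using vertical_depth(2)[OF c \<rho>0 M p z(1) _ d] R hz by simp
      then have "M * (12 * r) \<le> M * bdist \<Omega> (z + R *\<^sub>R e)" by (simp add: R_def mult_ac)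
      then show "12 * r \<le> bdist \<Omega> (z + R *\<^sub>R e)" using M by simp
      have XX: "C1 * X ^ \<beta> = C1 * (15 * M) ^ \<beta> * (r / bdist \<Omega> z) ^ \<beta>"
        by (simp only: X_def power_mult_distrib mult.assoc)
      have "g (z + R *\<^sub>R e) t \<le> C1 * X ^ \<beta> * g z t"
        using vc(1) mult_right_mono[OF n(2) g_nonneg[OF z(1) t]] by linarith
      then show "g (z + R *\<^sub>R e) t \<le> C1 * (15 * M) ^ \<beta> * (r / bdist \<Omega> z) ^ \<beta> * g z t" by (simp only: XX)
      have "g z t \<le> C1 * X ^ \<beta> * g (z + R *\<^sub>R e) t"
        using vc(2) mult_right_mono[OF n(2) g_nonneg[OF top t]] by linarith
      then show "g z t \<le> C1 * (15 * M) ^ \<beta> * (r / bdist \<Omega> z) ^ \<beta> * g (z + R *\<^sub>R e) t" by (simp only: XX)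
    qed
    note fx = factor[OF x] and fy = factor[OF y]
    have "dist (x + R *\<^sub>R e) (y + R *\<^sub>R e) \<le> bdist \<Omega> (y + R *\<^sub>R e) / 2"
      using fy(4) x(2) y(2) dist_triangle[of x y p] by (simp add: dist_commute)
    then have hh: "g (x + R *\<^sub>R e) t \<le> C1 * g (y + R *\<^sub>R e) t" by (rule harnack[OF fy(3) fx(3) _ t])
    define a where "a = C1 * (15 * M) ^ \<beta> * (r / bdist \<Omega> x) ^ \<beta>"
    define b where "b = C1 * (15 * M) ^ \<beta> * (r / bdist \<Omega> y) ^ \<beta>"
    have ab: "0 \<le> a" "0 \<le> b" using C1 M r by (auto simp: a_def b_def nonneg_bdist)
    have "g x t \<le> a * g (x + R *\<^sub>R e) t" using fx(2) by (simp add: a_def)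
    also have "\<dots> \<le> a * (C1 * g (y + R *\<^sub>R e) t)" by (intro mult_left_mono hh ab)
    also have "\<dots> \<le> a * (C1 * (b * g y t))"
      using fy(1) C1 ab by (intro mult_left_mono) (auto simp: b_def)
    also have "\<dots> = B * (r / bdist \<Omega> x) ^ \<beta> * (r / bdist \<Omega> y) ^ \<beta> * g y t"
      by (simp add: a_def b_def B_def power3_eq_cube mult_ac)
    finally show ?thesis .
  qed
  have "0 < B" "0 < \<rho>0 / (31 * M)" using C1 M \<rho>0 by (auto simp: B_def)
  then show ?thesis using main by blast
qed

end

section \<open>Decay at the boundary\<close>


text \<open>With \<open>\<alpha> = DIM('a) / a\<^sup>2\<close> the function \<open>exp (- \<alpha> * (dist q y)\<^sup>2)\<close> is strictly subharmonic outside the ball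
  of radius \<open>a\<close>. The barrier that is \<open>0\<close> on the sphere of radius \<open>a\<close> and \<open>S\<close> on the sphere of radius \<open>A\<close> is
  therefore strictly superharmonic between them, and dominates \<open>u\<close>.\<close>

lemma exp_barrier:
  fixes \<Omega> :: "'a::euclidean_space set" and u :: "'a \<Rightarrow> real"
  assumes wl: "weak_laplace \<Omega> u f" and f: "\<And>y. y \<in> \<Omega> \<Longrightarrow> 0 \<le> f y"
    and aA: "0 < a" "a < A" and ext: "ball q a \<inter> \<Omega> = {}"
    and van: "vanishes_on \<Omega> (frontier \<Omega> \<inter> cball q A) u"
    and S: "0 < S" "\<And>y. y \<in> \<Omega> \<Longrightarrow> dist q y \<le> A \<Longrightarrow> u y \<le> S"
    and x: "x \<in> \<Omega>" "dist q x \<le> A"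
  defines "\<alpha> \<equiv> DIM('a) / a\<^sup>2"
  shows "u x * (exp (- \<alpha> * a\<^sup>2) - exp (- \<alpha> * A\<^sup>2)) \<le> S * (exp (- \<alpha> * a\<^sup>2) - exp (- \<alpha> * (dist q x)\<^sup>2))"
proof -
  define E where "E r = exp (- \<alpha> * r\<^sup>2)" for r
  have \<alpha>: "0 < \<alpha>" "\<alpha> * a\<^sup>2 = DIM('a)" using aA by (auto simp: \<alpha>_def)
  have "a\<^sup>2 < A\<^sup>2" using aA by (intro power_strict_mono) auto
  then have "\<alpha> * a\<^sup>2 < \<alpha> * A\<^sup>2" using \<alpha>(1) by (rule mult_strict_left_mono)
  then have EaA: "0 < E a - E A" unfolding E_def by simp
  define K where "K = S / (E a - E A)"
  have K: "0 < K" using S EaA by (simp add: K_def)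
  define w where "w y = K * (E a - exp (- \<alpha> * ((y - q) \<bullet> (y - q))))" for y
  have w_eq: "w y = K * (E a - E (dist q y))" for y
    by (simp add: w_def E_def dist_norm norm_minus_commute power2_norm_eq_inner[symmetric])
  have cont: "continuous_on \<Omega> u" "open \<Omega>" using wl by (auto simp: weak_laplace_def)
  let ?P = "cball q A - ball q a"
  have P: "compact ?P" "?P \<noteq> {}" using ext x by (auto intro!: compact_diff)
  have "continuous_on ?P (\<lambda>y. zero_ext \<Omega> u y - w y)"
    unfolding w_def
    by (intro continuous_intros continuous_on_subset[OF zero_ext_continuous[OF cont(2,1) van]]) auto
  from continuous_attains_sup[OF P this] obtain z where z: "z \<in> ?P"
    "\<And>y. y \<in> ?P \<Longrightarrow> zero_ext \<Omega> u y - w y \<le> zero_ext \<Omega> u z - w z" by blast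
  have "zero_ext \<Omega> u z - w z \<le> 0"
  proof (cases "z \<in> \<Omega> \<and> dist q z < A")
    case False
    have "a\<^sup>2 \<le> (dist q z)\<^sup>2" using z(1) aA by (intro power_mono) auto
    then have "\<alpha> * a\<^sup>2 \<le> \<alpha> * (dist q z)\<^sup>2" using \<alpha>(1) by (intro mult_left_mono) auto
    then have "E (dist q z) \<le> E a" unfolding E_def by simp
    then have "0 \<le> w z" using K by (simp add: w_eq)
    moreover have "w z = S" if "dist q z = A" using that EaA by (simp add: w_eq K_def)
    ultimately show ?thesis using False S(2)[of z] z(1) by (auto simp: zero_ext_def)
  next
    case True
    define V where "V = \<Omega> \<inter> ball q A"
    have "open V" "z \<in> V" using cont(2) True by (auto simp: V_def)
    then obtain R where R: "0 < R" "cball z R \<subseteq> V" using open_contains_cball by blast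
    have "V \<subseteq> ?P" using ext by (auto simp: V_def)
    define e2 where "e2 y = exp (- \<alpha> * ((y - q) \<bullet> (y - q)))" for y
    have "\<exists>y\<in>cball z R. u z - w z < u y - w y"
    proof (rule no_local_max[OF wl R(1)])
      show "cball z R \<subseteq> \<Omega>" using R(2) by (auto simp: V_def)
      show "0 \<le> f y" if "y \<in> cball z R" for y using f R(2) that by (auto simp: V_def)
      show "continuous_on (cball z R) w" unfolding w_def by (intro continuous_intros)
      show "((\<lambda>t. w (y + t *\<^sub>R b)) has_real_derivative K * (2 * \<alpha> * ((y - q) \<bullet> b) * e2 y)) (at 0)" for y b
        unfolding w_def e2_def by (auto intro!: derivative_eq_intros sq_dist_line_deriv)
      show "((\<lambda>t. K * (2 * \<alpha> * ((y + t *\<^sub>R b - q) \<bullet> b) * e2 (y + t *\<^sub>R b))) has_real_derivative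
          K * (2 * \<alpha> * (b \<bullet> b) - 4 * \<alpha>\<^sup>2 * ((y - q) \<bullet> b)\<^sup>2) * e2 y) (at 0)" for y b
        unfolding e2_def
        by (rule derivative_eq_intros sq_dist_line_deriv inner_line_deriv refl)+
          (simp add: algebra_simps power2_eq_square)
      show "(\<Sum>b\<in>(Basis::'a set). K * (2 * \<alpha> * (b \<bullet> b) - 4 * \<alpha>\<^sup>2 * ((y - q) \<bullet> b)\<^sup>2) * e2 y)
          \<le> - (2 * K * \<alpha> * DIM('a) * E A)" if y: "y \<in> ball z R" for y
      proof -
        have yV: "y \<in> V" using y R(2) by auto
        have "(\<Sum>b\<in>Basis. ((y - q) \<bullet> b)\<^sup>2) = (y - q) \<bullet> (y - q)"
          by (simp add: euclidean_inner[of "y - q" "y - q"] power2_eq_square)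
        also have "\<dots> = (dist q y)\<^sup>2" by (simp add: dist_norm norm_minus_commute[of q y] power2_norm_eq_inner)
        finally have n: "(\<Sum>b\<in>Basis. ((y - q) \<bullet> b)\<^sup>2) = (dist q y)\<^sup>2" .
        have "(\<Sum>b\<in>(Basis::'a set). K * (2 * \<alpha> * (b \<bullet> b) - 4 * \<alpha>\<^sup>2 * ((y - q) \<bullet> b)\<^sup>2) * e2 y)
          = (K * e2 y) * (\<Sum>b\<in>(Basis::'a set). 2 * \<alpha> - 4 * \<alpha>\<^sup>2 * ((y - q) \<bullet> b)\<^sup>2)"
          unfolding sum_distrib_left by (intro sum.cong) auto
        also have "\<dots> = (K * e2 y) * (2 * \<alpha> * DIM('a) - 4 * \<alpha>\<^sup>2 * (dist q y)\<^sup>2)"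
          by (simp add: sum_subtractf n flip: sum_distrib_left)
        also have "\<dots> \<le> (K * e2 y) * - (2 * \<alpha> * DIM('a))"
        proof (rule mult_left_mono)
          have "a \<le> dist q y" using yV \<open>V \<subseteq> ?P\<close> by auto
          then have "a\<^sup>2 \<le> (dist q y)\<^sup>2" using aA by (intro power_mono) auto
          then have "(4 * \<alpha>\<^sup>2) * a\<^sup>2 \<le> (4 * \<alpha>\<^sup>2) * (dist q y)\<^sup>2" by (intro mult_left_mono) auto
          moreover have "(4 * \<alpha>\<^sup>2) * a\<^sup>2 = 4 * \<alpha> * DIM('a)" using \<alpha>(2) by (simp add: power2_eq_square mult.assoc)
          ultimately show "2 * \<alpha> * DIM('a) - 4 * \<alpha>\<^sup>2 * (dist q y)\<^sup>2 \<le> - (2 * \<alpha> * DIM('a))" by linarith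
        qed (use K in \<open>simp add: e2_def\<close>)
        also have "\<dots> = - ((2 * K * \<alpha> * DIM('a)) * e2 y)" by simp
        also have "\<dots> \<le> - ((2 * K * \<alpha> * DIM('a)) * E A)"
        proof -
          have "(dist q y)\<^sup>2 \<le> A\<^sup>2" using yV by (intro power_mono) (auto simp: V_def)
          then have "E A \<le> E (dist q y)" using \<alpha> by (simp add: E_def)
          moreover have "e2 y = E (dist q y)"
            by (simp add: e2_def E_def dist_norm norm_minus_commute[of q y] power2_norm_eq_inner)
          ultimately show ?thesis using K \<alpha> by (intro le_imp_neg_le mult_left_mono) auto
        qed
        finally show ?thesis .
      qed
      show "- (2 * K * \<alpha> * DIM('a) * E A) < 0" using K \<alpha> by (simp add: E_def)
    qed
    then obtain y where "y \<in> cball z R" "u z - w z < u y - w y" by blast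
    moreover have "y \<in> V" using \<open>y \<in> cball z R\<close> R(2) by blast
    then have "y \<in> \<Omega>" "y \<in> ?P" using \<open>V \<subseteq> ?P\<close> by (auto simp only: V_def)
    ultimately show ?thesis using z(2)[of y] True by (auto simp: zero_ext_def)
  qed
  then have "u x \<le> w x" using z(2)[of x] x ext by (fastforce simp: zero_ext_def)
  then have "u x * (E a - E A) \<le> S * (E a - E (dist q x))"
    using EaA by (simp add: w_eq K_def field_simps)
  then show ?thesis by (simp add: E_def)
qed

lemma vanishes_on_subset: "vanishes_on \<Omega> A u \<Longrightarrow> B \<subseteq> A \<Longrightarrow> vanishes_on \<Omega> B u"
  by (auto simp: vanishes_on_def)

definition weakly_subharmonic :: "'a::euclidean_space set \<Rightarrow> ('a \<Rightarrow> real) \<Rightarrow> bool"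
  where "weakly_subharmonic \<Omega> u \<longleftrightarrow> (\<exists>f. weak_laplace \<Omega> u f \<and> (\<forall>y\<in>\<Omega>. 0 \<le> f y))"

text \<open>The barrier for the exterior ball of radius \<open>\<kappa> * \<rho>\<close> and the larger radius \<open>3 / 4 * \<rho>\<close>. The ball of radius
  \<open>\<rho> / 4\<close> about \<open>p\<close> lies within \<open>3 / 8 * \<rho>\<close> of \<open>q\<close>, where the barrier is a fixed fraction of \<open>S\<close>.\<close>

lemma oscillation_decay:
  fixes \<Omega> :: "'a::euclidean_space set"
  assumes "bounded_lipschitz_domain \<Omega>"
  shows "\<exists>\<rho>0>0. \<exists>\<theta>. 0 < \<theta> \<and> \<theta> < 1 \<and> (\<forall>u p \<rho> S. weakly_subharmonic \<Omega> u \<and>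
     p \<in> frontier \<Omega> \<and> 0 < \<rho> \<and> \<rho> \<le> \<rho>0 \<and> vanishes_on \<Omega> (frontier \<Omega> \<inter> ball p \<rho>) u \<and> 0 < S \<and>
     (\<forall>y\<in>\<Omega> \<inter> ball p \<rho>. u y \<le> S) \<longrightarrow> (\<forall>y\<in>\<Omega> \<inter> ball p (\<rho> / 4). u y \<le> \<theta> * S))"
proof -
  obtain \<rho>0 \<kappa> where \<rho>0: "0 < \<rho>0" and \<kappa>: "0 < \<kappa>" "\<kappa> \<le> 1/8" and ext:
    "\<And>p \<rho>. p \<in> frontier \<Omega> \<Longrightarrow> 0 < \<rho> \<Longrightarrow> \<rho> \<le> \<rho>0 \<Longrightarrow> \<exists>q. dist p q = \<rho> / 8 \<and> ball q (\<kappa> * \<rho>) \<inter> \<Omega> = {}"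
    using exterior_balls[OF assms] by blast
  define N where "N = real DIM('a)"
  have N: "0 < N" by (simp add: N_def)
  define Ea Eb Ec where "Ea = exp (- N)" and "Eb = exp (- (9 * N / (64 * \<kappa>\<^sup>2)))"
    and "Ec = exp (- (9 * N / (16 * \<kappa>\<^sup>2)))"
  have "\<kappa>\<^sup>2 \<le> (1/8)\<^sup>2" using \<kappa> by (intro power_mono) auto
  then have k2: "\<kappa>\<^sup>2 \<le> 1/64" by (simp add: power2_eq_square)
  have k0: "0 < \<kappa>\<^sup>2" using \<kappa> by simp
  have "N * (64 * \<kappa>\<^sup>2) < N * 9" using k2 N by (intro mult_strict_left_mono) auto
  then have "N < 9 * N / (64 * \<kappa>\<^sup>2)" using k0 by (simp add: field_simps)
  then have ab: "Eb < Ea" by (simp add: Ea_def Eb_def)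
  have bc: "Ec < Eb" using N k0 by (simp add: Eb_def Ec_def field_simps)
  define \<theta> where "\<theta> = (Ea - Eb) / (Ea - Ec)"
  have \<theta>: "0 < \<theta>" "\<theta> < 1" using ab bc by (auto simp: \<theta>_def)
  have "u y \<le> \<theta> * S"
    if sub: "weakly_subharmonic \<Omega> u" and p: "p \<in> frontier \<Omega>"
      and \<rho>: "0 < \<rho>" "\<rho> \<le> \<rho>0" and van: "vanishes_on \<Omega> (frontier \<Omega> \<inter> ball p \<rho>) u"
      and S: "0 < S" "\<forall>y\<in>\<Omega> \<inter> ball p \<rho>. u y \<le> S" and y: "y \<in> \<Omega> \<inter> ball p (\<rho> / 4)"
    for u p \<rho> S y
  proof -
    obtain f where wl: "weak_laplace \<Omega> u f" and f: "\<forall>y\<in>\<Omega>. 0 \<le> f y"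
      using sub by (auto simp: weakly_subharmonic_def)
    obtain q where q: "dist p q = \<rho> / 8" "ball q (\<kappa> * \<rho>) \<inter> \<Omega> = {}" using ext[OF p \<rho>] by blast
    have in_ball: "dist p x < \<rho>" if "dist q x \<le> 3 / 4 * \<rho>" for x
      using dist_triangle[of p x q] q(1) that \<rho> by linarith
    have qy: "dist q y \<le> 3 / 8 * \<rho>" using dist_triangle[of q y p] y q(1) by (simp add: dist_commute)
    define \<alpha> where "\<alpha> = DIM('a) / (\<kappa> * \<rho>)\<^sup>2"
    have \<alpha>: "\<alpha> * (\<kappa> * \<rho>)\<^sup>2 = N" "0 < \<alpha>" using \<kappa> \<rho> by (auto simp: \<alpha>_def N_def)
    then have \<alpha>\<rho>: "\<alpha> * \<rho>\<^sup>2 = N / \<kappa>\<^sup>2" using \<kappa> by (simp add: power_mult_distrib field_simps)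
    have bar: "u y * (exp (- \<alpha> * (\<kappa> * \<rho>)\<^sup>2) - exp (- \<alpha> * (3 / 4 * \<rho>)\<^sup>2))
        \<le> S * (exp (- \<alpha> * (\<kappa> * \<rho>)\<^sup>2) - exp (- \<alpha> * (dist q y)\<^sup>2))"
      unfolding \<alpha>_def
    proof (rule exp_barrier[OF wl _ _ _ q(2) _ S(1)])
      show "vanishes_on \<Omega> (frontier \<Omega> \<inter> cball q (3 / 4 * \<rho>)) u"
        by (rule vanishes_on_subset[OF van]) (use in_ball in auto)
      show "\<kappa> * \<rho> < 3 / 4 * \<rho>" using \<kappa> \<rho> by (intro mult_strict_right_mono) auto
      show "dist q y \<le> 3 / 4 * \<rho>" using qy \<rho> by simp
    qed (use f \<kappa> \<rho> y S(2) in_ball in auto)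
    have 1: "exp (- \<alpha> * (\<kappa> * \<rho>)\<^sup>2) = Ea" using \<alpha> by (simp add: Ea_def)
    have "\<alpha> * (3 / 4 * \<rho>)\<^sup>2 = 9 / 16 * (\<alpha> * \<rho>\<^sup>2)" by (simp add: power_mult_distrib power_divide)
    then have 2: "exp (- \<alpha> * (3 / 4 * \<rho>)\<^sup>2) = Ec" by (simp add: Ec_def \<alpha>\<rho>)
    have "\<alpha> * (dist q y)\<^sup>2 \<le> \<alpha> * (3 / 8 * \<rho>)\<^sup>2"
      using qy \<alpha> by (intro mult_left_mono power_mono) auto
    also have "\<dots> = 9 / 64 * (\<alpha> * \<rho>\<^sup>2)" by (simp add: power_mult_distrib power_divide)
    finally have 3: "Eb \<le> exp (- \<alpha> * (dist q y)\<^sup>2)" by (simp add: Eb_def \<alpha>\<rho>)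
    have "u y * (Ea - Ec) \<le> S * (Ea - exp (- \<alpha> * (dist q y)\<^sup>2))" using bar unfolding 1 2 .
    also have "\<dots> \<le> S * (Ea - Eb)" using 3 S(1) by (intro mult_left_mono) auto
    finally show ?thesis using ab bc by (simp add: \<theta>_def field_simps)
  qed
  then show ?thesis using \<rho>0 \<theta> by blast
qed

definition boundary_decay_at :: "'a::euclidean_space set \<Rightarrow> real \<Rightarrow> real \<Rightarrow> real \<Rightarrow> bool"
  where "boundary_decay_at \<Omega> \<rho>0 \<epsilon> \<zeta> \<longleftrightarrow> (\<forall>u z s S. weakly_subharmonic \<Omega> u \<longrightarrow> 0 < s \<longrightarrow> s \<le> \<rho>0 \<longrightarrow> z \<in> \<Omega> \<longrightarrow>
     vanishes_on \<Omega> (frontier \<Omega> \<inter> ball z s) u \<longrightarrow> 0 < S \<longrightarrow> (\<forall>y\<in>\<Omega> \<inter> ball z s. u y \<le> S) \<longrightarrow>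
     bdist \<Omega> z \<le> \<zeta> * s \<longrightarrow> u z \<le> \<epsilon> * S)"

lemma boundary_decayD:
  "boundary_decay_at \<Omega> \<rho>0 \<epsilon> \<zeta> \<Longrightarrow> weakly_subharmonic \<Omega> u \<Longrightarrow> 0 < s \<Longrightarrow> s \<le> \<rho>0 \<Longrightarrow> z \<in> \<Omega> \<Longrightarrow>
     vanishes_on \<Omega> (frontier \<Omega> \<inter> ball z s) u \<Longrightarrow> 0 < S \<Longrightarrow> (\<And>y. y \<in> \<Omega> \<Longrightarrow> y \<in> ball z s \<Longrightarrow> u y \<le> S) \<Longrightarrow>
     bdist \<Omega> z \<le> \<zeta> * s \<Longrightarrow> u z \<le> \<epsilon> * S"
  unfolding boundary_decay_at_def by blast

text \<open>Apply \<open>oscillation_decay\<close> \<open>k\<close> times at the boundary point nearest to \<open>z\<close>, in balls whose radii shrink by the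
  factor 4.\<close>

lemma boundary_decay:
  fixes \<Omega> :: "'a::euclidean_space set"
  assumes lip: "bounded_lipschitz_domain \<Omega>"
  shows "\<exists>\<rho>0>0. \<forall>\<epsilon>>0. \<exists>\<zeta>>0. \<zeta> < 1 \<and> boundary_decay_at \<Omega> \<rho>0 \<epsilon> \<zeta>"
proof -
  obtain \<rho>0 \<theta> where \<rho>0: "0 < \<rho>0" and \<theta>: "0 < \<theta>" "\<theta> < 1" and step:
    "\<And>u p \<rho> S y. weakly_subharmonic \<Omega> u \<Longrightarrow> p \<in> frontier \<Omega> \<Longrightarrow> 0 < \<rho> \<Longrightarrow> \<rho> \<le> \<rho>0 \<Longrightarrow> vanishes_on \<Omega> (frontier \<Omega> \<inter> ball p \<rho>) u \<Longrightarrow> 0 < S \<Longrightarrow>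
     (\<forall>y\<in>\<Omega> \<inter> ball p \<rho>. u y \<le> S) \<Longrightarrow> \<forall>y\<in>\<Omega> \<inter> ball p (\<rho> / 4). u y \<le> \<theta> * S"
    using oscillation_decay[OF lip] by metis
  have "\<exists>\<zeta>>0. \<zeta> < 1 \<and> boundary_decay_at \<Omega> \<rho>0 \<epsilon> \<zeta>" if \<epsilon>: "0 < \<epsilon>" for \<epsilon>
  proof -
    obtain k where k: "\<theta> ^ k < \<epsilon>" using real_arch_pow_inv[OF \<epsilon> \<theta>(2)] by blast
    define \<zeta> where "\<zeta> = 1 / (4 * 4 ^ k :: real)"
    have k1: "(1::real) \<le> 4 ^ k" by simp
    have \<zeta>: "0 < \<zeta>" "\<zeta> \<le> 1 / 4" using k1 by (auto simp: \<zeta>_def field_simps)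
    have "u z \<le> \<epsilon> * S" if sh: "weakly_subharmonic \<Omega> u"
      and s: "0 < s" "s \<le> \<rho>0" and z: "z \<in> \<Omega>" and van: "vanishes_on \<Omega> (frontier \<Omega> \<inter> ball z s) u"
      and S: "0 < S" "\<forall>y\<in>\<Omega> \<inter> ball z s. u y \<le> S" and dz: "bdist \<Omega> z \<le> \<zeta> * s" for u z s S
    proof -
      have "open \<Omega>" "bounded \<Omega>" using lip by (auto simp: bounded_lipschitz_domain_def)
      then obtain p where p: "p \<in> frontier \<Omega>" "dist z p = bdist \<Omega> z"
        using nearest_frontier_point z by blast
      have "\<zeta> * s \<le> 1 / 4 * s" using \<zeta> s by (intro mult_right_mono) auto
      then have zp: "dist z p \<le> s / 4" using dz p(2) by simp
      have sub: "ball p (s / 2) \<subseteq> ball z s"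
      proof
        fix x assume "x \<in> ball p (s / 2)"
        then show "x \<in> ball z s" using dist_triangle[of z x p] zp s by auto
      qed
      have "\<forall>y\<in>\<Omega> \<inter> ball p (s / 2 / 4 ^ i). u y \<le> \<theta> ^ i * S" for i
      proof (induction i)
        case 0 then show ?case using S(2) sub by auto
      next
        case (Suc i)
        have i1: "(1::real) \<le> 4 ^ i" by simp
        have le: "s / 2 / 4 ^ i \<le> s / 2 / 1" using s i1 by (intro divide_left_mono) auto
        have "\<forall>y\<in>\<Omega> \<inter> ball p (s / 2 / 4 ^ i / 4). u y \<le> \<theta> * (\<theta> ^ i * S)"
        proof (rule step[OF sh p(1) _ _ _ _ Suc])
          show "vanishes_on \<Omega> (frontier \<Omega> \<inter> ball p (s / 2 / 4 ^ i)) u"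
            by (rule vanishes_on_subset[OF van]) (use sub le in auto)
        qed (use s S \<theta> le in auto)
        then show ?case by (simp add: mult.assoc)
      qed
      moreover have "z \<in> ball p (s / 2 / 4 ^ k)"
      proof -
        have "\<zeta> * s < s / 2 / 4 ^ k" using s by (simp add: \<zeta>_def field_simps)
        then show ?thesis using dz p(2) by (simp add: dist_commute)
      qed
      ultimately have "u z \<le> \<theta> ^ k * S" using z by blast
      also have "\<dots> \<le> \<epsilon> * S" using k S by (intro mult_right_mono) auto
      finally show ?thesis .
    qed
    then have "boundary_decay_at \<Omega> \<rho>0 \<epsilon> \<zeta>" unfolding boundary_decay_at_def by blast
    then show ?thesis using \<zeta> by (intro exI[of _ \<zeta>]) auto
  qed
  then show ?thesis using \<rho>0 by blast
qed

section \<open>The estimate away from the support of the boundary values\<close>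


definition carleson_at :: "'a::euclidean_space set \<Rightarrow> nat \<Rightarrow> real \<Rightarrow> real \<Rightarrow> bool"
  where "carleson_at \<Omega> \<gamma> \<rho>0 K \<longleftrightarrow> (\<forall>u x r A. weakly_subharmonic \<Omega> u \<longrightarrow> (\<forall>y\<in>\<Omega>. 0 \<le> u y) \<longrightarrow>
     0 < r \<longrightarrow> r \<le> \<rho>0 \<longrightarrow> x \<in> \<Omega> \<longrightarrow> 0 < u x \<longrightarrow> vanishes_on \<Omega> (frontier \<Omega> \<inter> cball x r) u \<longrightarrow>
     0 \<le> A \<longrightarrow> (\<forall>y\<in>\<Omega> \<inter> cball x r. u y \<le> A * (r / bdist \<Omega> y) ^ \<gamma>) \<longrightarrow>
     (\<forall>y\<in>\<Omega> \<inter> cball x (r / 2). u y \<le> K * A))"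

lemma carlesonD:
  "carleson_at \<Omega> \<gamma> \<rho>0 K \<Longrightarrow> weakly_subharmonic \<Omega> u \<Longrightarrow> (\<And>y. y \<in> \<Omega> \<Longrightarrow> 0 \<le> u y) \<Longrightarrow>
     0 < r \<Longrightarrow> r \<le> \<rho>0 \<Longrightarrow> x \<in> \<Omega> \<Longrightarrow> 0 < u x \<Longrightarrow> vanishes_on \<Omega> (frontier \<Omega> \<inter> cball x r) u \<Longrightarrow>
     0 \<le> A \<Longrightarrow> (\<And>y. y \<in> \<Omega> \<Longrightarrow> y \<in> cball x r \<Longrightarrow> u y \<le> A * (r / bdist \<Omega> y) ^ \<gamma>) \<Longrightarrow>
     y \<in> \<Omega> \<Longrightarrow> y \<in> cball x (r / 2) \<Longrightarrow> u y \<le> K * A"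
  unfolding carleson_at_def by blast

text \<open>A polynomial blow-up rate at the boundary together with boundary decay implies a bound. At the
  weighted maximum \<open>z\<close>, \<open>u\<close> is at most \<open>2 ^ \<gamma> * u z\<close> on the ball of radius \<open>s / 2\<close>; were \<open>z\<close> close to
  the boundary in comparison with \<open>s\<close>, decay by the factor \<open>1 / (2 * 2 ^ \<gamma>)\<close> would give \<open>u z \<le> u z / 2\<close>.
  Thus the depth of \<open>z\<close> is comparable to \<open>s\<close>, and the weight cancels the blow-up.\<close>

lemma carleson_estimate:
  fixes \<Omega> :: "'a::euclidean_space set"
  assumes lip: "bounded_lipschitz_domain \<Omega>" and \<gamma>: "0 < (\<gamma> :: nat)"
  shows "\<exists>\<rho>0>0. \<exists>K>0. carleson_at \<Omega> \<gamma> \<rho>0 K"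
proof -
  obtain \<rho>0 where \<rho>0: "0 < \<rho>0" and dec: "\<And>\<epsilon>. 0 < \<epsilon> \<Longrightarrow> \<exists>\<zeta>>0. \<zeta> < 1 \<and> boundary_decay_at \<Omega> \<rho>0 \<epsilon> \<zeta>"
    using boundary_decay[OF lip] by blast
  have "(0::real) < 1 / (2 * 2 ^ \<gamma>)" by simp
  from dec[OF this] obtain \<zeta> where \<zeta>: "0 < \<zeta>" and decay: "boundary_decay_at \<Omega> \<rho>0 (1 / (2 * 2 ^ \<gamma>)) \<zeta>"
    by blast
  have "u y \<le> (4 / \<zeta>) ^ \<gamma> * A"
    if sh: "weakly_subharmonic \<Omega> u" and u0: "\<forall>y\<in>\<Omega>. 0 \<le> u y"
      and r: "0 < r" "r \<le> \<rho>0" and x: "x \<in> \<Omega>" "0 < u x"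
      and van: "vanishes_on \<Omega> (frontier \<Omega> \<inter> cball x r) u" and A: "0 \<le> A"
      and bound: "\<forall>y\<in>\<Omega> \<inter> cball x r. u y \<le> A * (r / bdist \<Omega> y) ^ \<gamma>"
      and y: "y \<in> \<Omega> \<inter> cball x (r / 2)" for u x r A y
  proof -
    have cont: "open \<Omega>" "continuous_on \<Omega> u" using sh by (auto simp: weakly_subharmonic_def weak_laplace_def)
    have bdd: "bounded \<Omega>" using lip by (simp add: bounded_lipschitz_domain_def)
    obtain z where z: "z \<in> \<Omega>" "dist z x < r" "0 < u z"
      "\<And>y. y \<in> \<Omega> \<Longrightarrow> dist y x \<le> r \<Longrightarrow> u y * (r - dist y x) ^ \<gamma> \<le> u z * (r - dist z x) ^ \<gamma>"
      using weighted_max[OF cont van x r(1) \<gamma>] by blast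
    define s where "s = r - dist z x"
    have s: "0 < s" "s \<le> r" using z(2) by (auto simp: s_def)
    have sub: "dist y x \<le> r - s / 2" if "y \<in> ball z (s / 2)" for y
      using dist_triangle[of y x z] that by (simp add: s_def dist_commute field_simps)
    have deep: "\<zeta> * (s / 2) < bdist \<Omega> z"
    proof (rule ccontr)
      assume "\<not> ?thesis"
      then have d: "bdist \<Omega> z \<le> \<zeta> * (s / 2)" by simp
      have "u z \<le> 1 / (2 * 2 ^ \<gamma>) * (2 ^ \<gamma> * u z)"
      proof (rule boundary_decayD[OF decay sh _ _ z(1) _ _ _ d])
        show "vanishes_on \<Omega> (frontier \<Omega> \<inter> ball z (s / 2)) u"
          by (rule vanishes_on_subset[OF van]) (use sub s in \<open>force simp: dist_commute\<close>)
        show "u y \<le> 2 ^ \<gamma> * u z" if y: "y \<in> \<Omega>" "y \<in> ball z (s / 2)" for y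
        proof -
          have h: "s / 2 \<le> r - dist y x" using sub[OF y(2)] by simp
          have "u y * (s / 2) ^ \<gamma> \<le> u y * (r - dist y x) ^ \<gamma>"
            using h s u0 y by (intro mult_left_mono power_mono) auto
          also have "\<dots> \<le> u z * s ^ \<gamma>" using z(4)[of y] y h s by (simp add: s_def)
          finally show "u y \<le> 2 ^ \<gamma> * u z" using s by (simp add: power_divide field_simps)
        qed
      qed (use s r z in auto)
      then show False using z(3) by simp
    qed
    have bp: "0 < bdist \<Omega> z" using bdist_pos[OF cont(1) bdd z(1)] .
    have "u y * (r / 2) ^ \<gamma> \<le> u y * (r - dist y x) ^ \<gamma>"
      using y r u0 by (intro mult_left_mono power_mono) (auto simp: dist_commute)
    also have "\<dots> \<le> u z * s ^ \<gamma>" using z(4)[of y] y r by (simp add: s_def dist_commute)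
    also have "\<dots> \<le> (A * (r / bdist \<Omega> z) ^ \<gamma>) * s ^ \<gamma>"
      using bound z(1,2) s by (intro mult_right_mono) (auto simp: dist_commute)
    also have "\<dots> = A * (r * (s / bdist \<Omega> z)) ^ \<gamma>"
      by (simp add: power_mult_distrib power_divide)
    also have "\<dots> \<le> A * (r * (2 / \<zeta>)) ^ \<gamma>"
    proof -
      have "s / bdist \<Omega> z \<le> 2 / \<zeta>" using deep \<zeta> bp by (simp add: field_simps)
      then show ?thesis using A r s bp by (intro mult_left_mono power_mono) auto
    qed
    also have "\<dots> = ((4 / \<zeta>) ^ \<gamma> * A) * (r / 2) ^ \<gamma>"
      by (simp add: mult.assoc flip: power_mult_distrib) (simp add: mult_ac power_mult_distrib[symmetric])
    finally show ?thesis using r by simp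
  qed
  then have "carleson_at \<Omega> \<gamma> \<rho>0 ((4 / \<zeta>) ^ \<gamma>)" unfolding carleson_at_def by blast
  then show ?thesis using \<rho>0 \<zeta> by (intro exI[of _ \<rho>0] conjI exI[of _ "(4 / \<zeta>) ^ \<gamma>"]) auto
qed

context absorption begin

text \<open>If \<open>u x > 0\<close>, adding a small paraboloid centred at \<open>x\<close> leaves the maximum over the closure in the interior,
  although the sum is strictly subharmonic.\<close>

lemma zero_if_vanishes_everywhere:
  assumes sol: "nonneg_solution \<Omega> g u" and van: "vanishes_on \<Omega> (frontier \<Omega>) u" and x: "x \<in> \<Omega>"
  shows "u x = 0"
proof (rule ccontr)
  assume "u x \<noteq> 0"
  note u = solutionD[OF sol]
  have pos: "0 < u x" using u(3)[OF x] \<open>u x \<noteq> 0\<close> by simp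
  obtain D where D: "1 \<le> D" "\<And>x y. x \<in> closure \<Omega> \<Longrightarrow> y \<in> closure \<Omega> \<Longrightarrow> dist x y \<le> D"
    using diameter_bound by blast
  define \<eta> where "\<eta> = u x / (2 * D\<^sup>2)"
  have \<eta>: "0 < \<eta>" using pos D by (simp add: \<eta>_def)
  define w where "w y = - \<eta> * ((y - x) \<bullet> (y - x))" for y
  have w_eq: "w y = - \<eta> * (dist x y)\<^sup>2" for y
    by (simp add: w_def dist_norm norm_minus_commute power2_norm_eq_inner[symmetric])
  have xc: "x \<in> closure \<Omega>" using x closure_subset by blast
  have cl: "compact (closure \<Omega>)" "closure \<Omega> \<noteq> {}" using bounded_\<Omega> xc by (auto simp: compact_closure)
  have "continuous_on (closure \<Omega>) (\<lambda>y. zero_ext \<Omega> u y - w y)"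
    unfolding w_def
    by (intro continuous_intros zero_ext_continuous open_\<Omega> u(2) vanishes_on_subset[OF van]) auto
  from continuous_attains_sup[OF cl this] obtain z where z: "z \<in> closure \<Omega>"
    "\<And>y. y \<in> closure \<Omega> \<Longrightarrow> zero_ext \<Omega> u y - w y \<le> zero_ext \<Omega> u z - w z" by blast
  have "u x \<le> zero_ext \<Omega> u z - w z" using z(2)[OF xc] x by (simp add: zero_ext_def w_eq)
  moreover have "- w z \<le> u x / 2"
  proof -
    have "(dist x z)\<^sup>2 \<le> D\<^sup>2" using D(2)[OF xc z(1)] by (intro power_mono) auto
    then have "\<eta> * (dist x z)\<^sup>2 \<le> \<eta> * D\<^sup>2" using \<eta> by (intro mult_left_mono) auto
    then show ?thesis using D by (simp add: w_eq \<eta>_def)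
  qed
  ultimately have zO: "z \<in> \<Omega>" using pos by (auto simp: zero_ext_def split: if_splits)
  then obtain R where R: "0 < R" "cball z R \<subseteq> \<Omega>" using open_contains_cball open_\<Omega> by blast
  have "\<exists>y\<in>cball z R. u z - w z < u y - w y"
  proof (rule no_local_max[OF u(1) R])
    show "0 \<le> g y (u y)" if "y \<in> cball z R" for y using g_nonneg u(3) that R(2) by blast
    show "continuous_on (cball z R) w" unfolding w_def by (intro continuous_intros)
    show "((\<lambda>t. w (y + t *\<^sub>R b)) has_real_derivative - 2 * \<eta> * ((y - x) \<bullet> b)) (at 0)" for y b
      unfolding w_def by (auto intro!: derivative_eq_intros sq_dist_line_deriv)
    show "((\<lambda>t. - 2 * \<eta> * ((y + t *\<^sub>R b - x) \<bullet> b)) has_real_derivative - 2 * \<eta> * (b \<bullet> b)) (at 0)" for y b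
      by (auto intro!: derivative_eq_intros inner_line_deriv)
    show "(\<Sum>b\<in>(Basis::'a set). - 2 * \<eta> * (b \<bullet> b)) \<le> - 2 * \<eta> * DIM('a)" by simp
    show "- 2 * \<eta> * DIM('a) < 0" using \<eta> by simp
  qed
  then obtain y where y: "y \<in> cball z R" "u z - w z < u y - w y" by blast
  then have "y \<in> \<Omega>" using R(2) by blast
  then show False using z(2)[of y] zO y(2) closure_subset[of \<Omega>] by (auto simp: zero_ext_def)
qed

text \<open>If \<open>t = u y\<close> violated the bound, \<open>KO_growth\<close> at \<open>x\<close> with \<open>X = (d / \<delta> y) ^ (\<beta> + 2)\<close> would make
  \<open>g x t / t\<close> larger than \<open>(d / \<delta> y) ^ (\<beta> + 2) / d\<^sup>2\<close> times a big constant, while \<open>boundary_chain\<close> and the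
  interior estimate at \<open>y\<close> bound it by a constant times \<open>(d / \<delta> y) ^ \<beta> / (\<delta> y)\<^sup>2\<close>, the same power.\<close>

lemma polynomial_bound:
  obtains \<gamma> :: nat and \<rho> c where "0 < \<gamma>" "0 < \<rho>" "0 < c"
    "\<And>u q r d x y A. nonneg_solution \<Omega> g u \<Longrightarrow> q \<in> frontier \<Omega> \<Longrightarrow> 0 < r \<Longrightarrow> r \<le> \<rho> \<Longrightarrow> r \<le> d \<Longrightarrow>
     x \<in> \<Omega> \<Longrightarrow> y \<in> \<Omega> \<Longrightarrow> dist q x < 3 * r \<Longrightarrow> dist q y < 3 * r \<Longrightarrow> \<epsilon>0 * r \<le> bdist \<Omega> x \<Longrightarrow> bdist \<Omega> y \<le> d \<Longrightarrow>
     0 < A \<Longrightarrow> 8 * C2 ^ 3 * A \<le> g x A \<Longrightarrow> c * A < g x A * d\<^sup>2 \<Longrightarrow> u y \<le> A * (d / bdist \<Omega> y) ^ \<gamma>"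
proof -
  obtain p where p: "0 < p" "\<And>h a X t. KO_fun C2 h \<Longrightarrow> 0 < a \<Longrightarrow> 8 * C2 ^ 3 * a \<le> h a \<Longrightarrow> 1 \<le> X \<Longrightarrow>
    a * X ^ p \<le> t \<Longrightarrow> X\<^sup>2 * h a * t \<le> 32 * C2\<^sup>2 * h t * a" using KO_growth[of C2] by auto
  obtain c0 where c0: "0 < c0"
    "\<And>u x. nonneg_solution \<Omega> g u \<Longrightarrow> x \<in> \<Omega> \<Longrightarrow> g x (u x) * (bdist \<Omega> x)\<^sup>2 \<le> c0 * u x"
    using interior_estimate by blast
  obtain \<rho> \<beta> B where \<rho>: "0 < \<rho>" and B: "0 < B" and chain:
    "\<And>p r x y t. p \<in> frontier \<Omega> \<Longrightarrow> 0 < r \<Longrightarrow> r \<le> \<rho> \<Longrightarrow> x \<in> \<Omega> \<Longrightarrow> y \<in> \<Omega> \<Longrightarrow>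
     dist p x < 3 * r \<Longrightarrow> dist p y < 3 * r \<Longrightarrow> 0 \<le> t \<Longrightarrow>
     g x t \<le> B * (r / bdist \<Omega> x) ^ \<beta> * (r / bdist \<Omega> y) ^ \<beta> * g y t"
    using boundary_chain by blast
  define c where "c = 32 * C2\<^sup>2 * B * (1 / \<epsilon>0) ^ \<beta> * c0"
  have main: "u y \<le> A * (d / bdist \<Omega> y) ^ ((\<beta> + 2) * p)"
    if sol: "nonneg_solution \<Omega> g u" and q: "q \<in> frontier \<Omega>" and r: "0 < r" "r \<le> \<rho>" "r \<le> d"
      and xy: "x \<in> \<Omega>" "y \<in> \<Omega>" "dist q x < 3 * r" "dist q y < 3 * r" "\<epsilon>0 * r \<le> bdist \<Omega> x" "bdist \<Omega> y \<le> d"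
      and A: "0 < A" "8 * C2 ^ 3 * A \<le> g x A" "c * A < g x A * d\<^sup>2" for u q r d x y A
  proof (rule ccontr)
    note x = xy(1,3,5) and y = xy(2,4,6)
    define \<delta> where "\<delta> = bdist \<Omega> y"
    have \<delta>: "0 < \<delta>" "\<delta> \<le> d" using bdist_pos[OF open_\<Omega> bounded_\<Omega> y(1)] y(3) by (auto simp: \<delta>_def)
    define b where "b = d / \<delta>"
    have b: "1 \<le> b" using \<delta> by (simp add: b_def)
    define X where "X = b ^ (\<beta> + 2)"
    have X: "1 \<le> X" unfolding X_def by (rule one_le_power[OF b])
    define t where "t = u y"
    assume n: "\<not> u y \<le> A * (d / bdist \<Omega> y) ^ ((\<beta> + 2) * p)"
    have "X ^ p = (d / bdist \<Omega> y) ^ ((\<beta> + 2) * p)" by (simp only: X_def b_def \<delta>_def power_mult)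
    with n have "A * X ^ p \<le> t" unfolding t_def by simp
    then have gr: "X\<^sup>2 * g x A * t \<le> 32 * C2\<^sup>2 * g x t * A"
      using p(2)[OF KO_g[OF x(1)] A(1,2) X] by blast
    have "0 < A * X ^ p" using A X by simp
    then have t: "0 < t" using \<open>A * X ^ p \<le> t\<close> by linarith
    have gy: "0 \<le> g y t" using g_nonneg y t by simp
    have bx: "0 < bdist \<Omega> x" by (rule bdist_pos[OF open_\<Omega> bounded_\<Omega> x(1)])
    have "g x t \<le> B * (r / bdist \<Omega> x) ^ \<beta> * (r / \<delta>) ^ \<beta> * g y t"
      unfolding \<delta>_def using chain[OF q r(1,2) x(1) y(1) x(2) y(2)] t by simp
    also have "\<dots> \<le> B * (1 / \<epsilon>0) ^ \<beta> * b ^ \<beta> * g y t"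
    proof -
      have "r / bdist \<Omega> x \<le> 1 / \<epsilon>0" using x(3) \<epsilon>0 bx by (simp add: field_simps)
      moreover have "r / \<delta> \<le> b" unfolding b_def using r \<delta> by (intro divide_right_mono) auto
      ultimately show ?thesis using B r bx \<delta> \<epsilon>0 gy
        by (intro mult_right_mono mult_mono power_mono) auto
    qed
    finally have gx: "g x t \<le> B * (1 / \<epsilon>0) ^ \<beta> * b ^ \<beta> * g y t" .
    have int: "g y t * \<delta>\<^sup>2 \<le> c0 * t" using c0(2)[OF sol y(1)] by (simp add: t_def \<delta>_def)
    have gA: "0 < g x A" using A C2 by (smt (verit) mult_pos_pos zero_less_power)
    have "(b ^ (\<beta> + 2) * (g x A * d\<^sup>2)) * t \<le> (X\<^sup>2 * (g x A * d\<^sup>2)) * t"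
    proof -
      have "X * 1 \<le> X * X" using X by (intro mult_left_mono) auto
      then show ?thesis using gA t unfolding power2_eq_square[of X] X_def[symmetric]
        by (intro mult_right_mono) auto
    qed
    also have "\<dots> = (X\<^sup>2 * g x A * t) * d\<^sup>2" by simp
    also have "\<dots> \<le> (32 * C2\<^sup>2 * g x t * A) * d\<^sup>2" using gr by (intro mult_right_mono) auto
    also have "\<dots> = (32 * C2\<^sup>2 * A * d\<^sup>2) * g x t" by simp
    also have "\<dots> \<le> (32 * C2\<^sup>2 * A * d\<^sup>2) * (B * (1 / \<epsilon>0) ^ \<beta> * b ^ \<beta> * g y t)"
      using A by (intro mult_left_mono gx) auto
    also have "\<dots> = (32 * C2\<^sup>2 * A * B * (1 / \<epsilon>0) ^ \<beta> * b ^ (\<beta> + 2)) * (g y t * \<delta>\<^sup>2)"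
      using \<delta> by (simp add: b_def power_divide power2_eq_square)
    also have "\<dots> \<le> (32 * C2\<^sup>2 * A * B * (1 / \<epsilon>0) ^ \<beta> * b ^ (\<beta> + 2)) * (c0 * t)"
      using A B b \<epsilon>0 by (intro mult_left_mono int) auto
    also have "\<dots> = (b ^ (\<beta> + 2) * (c * A)) * t" by (simp add: c_def)
    finally have "b ^ (\<beta> + 2) * (g x A * d\<^sup>2) \<le> b ^ (\<beta> + 2) * (c * A)" by (rule mult_right_le_imp_le[OF _ t])
    then have "g x A * d\<^sup>2 \<le> c * A" using b by simp
    then show False using A(3) by simp
  qed
  show ?thesis
  proof (rule that[of "(\<beta> + 2) * p" \<rho> c])
    show "0 < c" using C2 B \<epsilon>0 c0 by (simp add: c_def)
    show "0 < (\<beta> + 2) * p" using p by simp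
  qed (rule \<rho>, rule main)
qed

text \<open>The constants are chosen in this order: \<open>\<kappa>\<close> (ratio of \<open>r\<close> to \<open>d\<close>), the bound \<open>L\<close> from the Carleson
  estimate, \<open>\<zeta>\<close> so that the decay beats \<open>L * C2\<close> by the factor 2, the depth threshold \<open>\<eta>\<close>, and last \<open>c\<close>.
  After the 1, the summands of \<open>c\<close> serve, in turn, the deep case, the polynomial bound at \<open>x'\<close>, and the threshold of
  \<open>KO_growth\<close>.\<close>

lemma estimate_nonempty:
  "\<exists>c\<ge>1. \<forall>F u x. closed F \<and> F \<noteq> {} \<and> F \<subseteq> frontier \<Omega> \<and> nonneg_solution \<Omega> g u \<and>
     vanishes_on \<Omega> (frontier \<Omega> - F) u \<and> x \<in> \<Omega> \<longrightarrow> g x (u x) * (infdist x F)\<^sup>2 \<le> c * u x"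
proof (rule polynomial_bound)
  obtain D where D: "1 \<le> D" "\<And>x y. x \<in> closure \<Omega> \<Longrightarrow> y \<in> closure \<Omega> \<Longrightarrow> dist x y \<le> D"
    using diameter_bound by blast
  obtain c0 where c0: "0 < c0"
    "\<And>u x. nonneg_solution \<Omega> g u \<Longrightarrow> x \<in> \<Omega> \<Longrightarrow> g x (u x) * (bdist \<Omega> x)\<^sup>2 \<le> c0 * u x"
    using interior_estimate by blast
  fix \<gamma> :: nat and \<rho>1 c1 assume \<gamma>: "0 < \<gamma>" and \<rho>1: "0 < \<rho>1" and c1: "0 < c1" and poly:
    "\<And>u q r d x y A. nonneg_solution \<Omega> g u \<Longrightarrow> q \<in> frontier \<Omega> \<Longrightarrow> 0 < r \<Longrightarrow> r \<le> \<rho>1 \<Longrightarrow> r \<le> d \<Longrightarrow>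
     x \<in> \<Omega> \<Longrightarrow> y \<in> \<Omega> \<Longrightarrow> dist q x < 3 * r \<Longrightarrow> dist q y < 3 * r \<Longrightarrow> \<epsilon>0 * r \<le> bdist \<Omega> x \<Longrightarrow> bdist \<Omega> y \<le> d \<Longrightarrow>
     0 < A \<Longrightarrow> 8 * C2 ^ 3 * A \<le> g x A \<Longrightarrow> c1 * A < g x A * d\<^sup>2 \<Longrightarrow> u y \<le> A * (d / bdist \<Omega> y) ^ \<gamma>"
  obtain \<rho>2 K where \<rho>2: "0 < \<rho>2" and K: "0 < K" and carleson: "carleson_at \<Omega> \<gamma> \<rho>2 K"
    using carleson_estimate[OF lipschitz \<gamma>] by blast
  obtain \<rho>3 where \<rho>3: "0 < \<rho>3" and dec: "\<And>\<epsilon>. 0 < \<epsilon> \<Longrightarrow> \<exists>\<zeta>>0. \<zeta> < 1 \<and> boundary_decay_at \<Omega> \<rho>3 \<epsilon> \<zeta>"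
    using boundary_decay[OF lipschitz] by blast
  define \<kappa> where "\<kappa> = Min {1 / 4, \<epsilon>0 / (2 * D), \<rho>1 / D, \<rho>2 / D, \<rho>3 / D}"
  have "0 < \<kappa>" unfolding \<kappa>_def using D \<epsilon>0 \<rho>1 \<rho>2 \<rho>3 by (subst Min_gr_iff) auto
  moreover have "\<kappa> \<le> 1 / 4" "\<kappa> \<le> \<epsilon>0 / (2 * D)" "\<kappa> \<le> \<rho>1 / D" "\<kappa> \<le> \<rho>2 / D" "\<kappa> \<le> \<rho>3 / D"
    unfolding \<kappa>_def by (rule Min_le; simp)+
  ultimately have \<kappa>: "0 < \<kappa>" "\<kappa> \<le> 1 / 4" "\<kappa> \<le> \<epsilon>0 / (2 * D)"
    "\<kappa> \<le> \<rho>1 / D" "\<kappa> \<le> \<rho>2 / D" "\<kappa> \<le> \<rho>3 / D" by auto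
  define L where "L = K * (1 / \<kappa>) ^ \<gamma>"
  have L: "0 < L" using K \<kappa> by (simp add: L_def)
  have "0 < 1 / (2 * L * C2)" using L C2 by simp
  from dec[OF this] obtain \<zeta> where \<zeta>: "0 < \<zeta>" "\<zeta> < 1"
    and decay: "boundary_decay_at \<Omega> \<rho>3 (1 / (2 * L * C2)) \<zeta>" by blast
  define \<eta> where "\<eta> = \<zeta> * \<kappa> / 2"
  have \<eta>: "0 < \<eta>" using \<zeta> \<kappa> by (simp add: \<eta>_def)
  define c where "c = 1 + c0 / \<eta>\<^sup>2 + c1 * C2\<^sup>2 + 8 * C2 ^ 5 * D\<^sup>2"
  have nn: "0 \<le> c0 / \<eta>\<^sup>2" "0 \<le> c1 * C2\<^sup>2" "0 \<le> 8 * C2 ^ 5 * D\<^sup>2" using c0 c1 C2 by auto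
  have c: "1 \<le> c" "c0 / \<eta>\<^sup>2 \<le> c" "c1 * C2\<^sup>2 \<le> c" "8 * C2 ^ 5 * D\<^sup>2 \<le> c"
    using nn unfolding c_def by linarith+
  have "g x (u x) * (infdist x F)\<^sup>2 \<le> c * u x"
    if F: "closed F" "F \<noteq> {}" "F \<subseteq> frontier \<Omega>" and sol: "nonneg_solution \<Omega> g u"
      and van: "vanishes_on \<Omega> (frontier \<Omega> - F) u" and x: "x \<in> \<Omega>" for F u x
  proof (rule ccontr)
    note u = solutionD[OF sol]
    define a where "a = u x"
    define d where "d = infdist x F"
    assume "\<not> ?thesis"
    then have contr: "c * a < g x a * d\<^sup>2" by (simp add: a_def d_def)
    then have "a \<noteq> 0" using g_zero[OF x] by auto
    then have a: "0 < a" using u(3)[OF x] by (simp add: a_def)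
    have ga: "0 \<le> g x a" using g_nonneg x a by simp
    have "0 < c * a" using c(1) a by simp
    then have "d \<noteq> 0" using contr by auto
    then have d: "0 < d" using infdist_nonneg[of x F] by (simp add: d_def)
    have xc: "x \<in> closure \<Omega>" using x closure_subset by blast
    obtain y0 where "y0 \<in> F" using F(2) by blast
    then have dD: "d \<le> D" using infdist_le[of y0 F x] D(2)[OF xc, of y0] F(3)
      by (force simp: d_def frontier_def)
    have shallow: "bdist \<Omega> x < \<eta> * d"
    proof (rule ccontr)
      assume "\<not> ?thesis"
      then have "(\<eta> * d)\<^sup>2 \<le> (bdist \<Omega> x)\<^sup>2" using \<eta> d by (intro power_mono) auto
      then have "g x a * (\<eta> * d)\<^sup>2 \<le> g x a * (bdist \<Omega> x)\<^sup>2" using ga by (rule mult_left_mono)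
      also have "\<dots> \<le> c0 * a" using c0(2)[OF sol x] by (simp add: a_def)
      finally have "g x a * d\<^sup>2 \<le> (c0 / \<eta>\<^sup>2) * a" using \<eta> by (simp add: field_simps)
      also have "\<dots> \<le> c * a" using c(2) a by (intro mult_right_mono) auto
      finally show False using contr by simp
    qed
    define r where "r = \<kappa> * d"
    have r0: "0 < r" "r \<le> d / 4" using \<kappa> d by (auto simp: r_def)
    have r_le: "r \<le> \<tau>" if "\<kappa> \<le> \<tau> / D" for \<tau>
    proof -
      have "r \<le> \<kappa> * D" using \<kappa> dD by (simp add: r_def)
      also have "\<dots> \<le> \<tau>" using that D(1) by (simp add: field_simps)
      finally show ?thesis .
    qed
    have r1: "r \<le> \<epsilon>0 / 2" "r \<le> \<rho>1" "r \<le> \<rho>2" "r \<le> \<rho>3"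
      using r_le[of "\<epsilon>0 / 2"] r_le \<kappa> by auto
    have bx: "bdist \<Omega> x < \<zeta> * (r / 2)" using shallow by (simp add: \<eta>_def r_def)
    have "\<zeta> * (r / 2) \<le> 1 * (r / 2)" using \<zeta> r0 by (intro mult_right_mono) auto
    then have bx2: "bdist \<Omega> x < r / 2" using bx by simp
    obtain x' where x': "dist x' x = r" "\<epsilon>0 * r \<le> bdist \<Omega> x'" "g x a \<le> C2 * g x' (C2 * a)"
      using QI x a r0 r1(1) bx2 \<epsilon>0 unfolding quasi_inwardly_increasing_def by force
    have "0 < bdist \<Omega> x'" using x'(2) \<epsilon>0 r0 by (smt (verit) mult_pos_pos)
    then have x'O: "x' \<in> \<Omega>" using mem_if_dist_less_bdist[of x' x' \<Omega>] by simp
    define A where "A = C2 * a"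
    have A: "0 < A" using C2 a by (simp add: A_def)
    have gA: "c * A < C2\<^sup>2 * (g x' A * d\<^sup>2)"
    proof -
      have "C2 * (c * a) < C2 * (g x a * d\<^sup>2)" using contr C2 by simp
      also have "\<dots> \<le> C2 * ((C2 * g x' A) * d\<^sup>2)"
        using x'(3) C2 by (intro mult_left_mono mult_right_mono) (auto simp: A_def)
      finally show ?thesis by (simp add: A_def power2_eq_square mult_ac)
    qed
    have g1: "c1 * A < g x' A * d\<^sup>2"
    proof -
      have "C2\<^sup>2 * (c1 * A) \<le> c * A" using mult_right_mono[OF c(3), of A] A by (simp add: mult_ac)
      then have "C2\<^sup>2 * (c1 * A) < C2\<^sup>2 * (g x' A * d\<^sup>2)" using gA by linarith
      then show ?thesis using C2 by simp
    qed
    have g2: "8 * C2 ^ 3 * A \<le> g x' A"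
    proof -
      have "0 \<le> g x' A" using g_nonneg x'O A by simp
      then have "g x' A * d\<^sup>2 \<le> g x' A * D\<^sup>2" using d dD by (intro mult_left_mono power_mono) auto
      then have "C2\<^sup>2 * (g x' A * d\<^sup>2) \<le> C2\<^sup>2 * (g x' A * D\<^sup>2)" by (rule mult_left_mono) simp
      then have "(8 * C2 ^ 5 * D\<^sup>2) * A \<le> C2\<^sup>2 * (g x' A * D\<^sup>2)"
        using gA mult_right_mono[OF c(4), of A] A by linarith
      then have "(C2\<^sup>2 * D\<^sup>2) * (8 * C2 ^ 3 * A) \<le> (C2\<^sup>2 * D\<^sup>2) * g x' A"
        by (simp add: power_numeral_reduce mult_ac)
      then show ?thesis using C2 D(1) by simp
    qed
    obtain q where q: "q \<in> frontier \<Omega>" "dist x q = bdist \<Omega> x"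
      using nearest_frontier_point[OF open_\<Omega> bounded_\<Omega> x] .
    have up: "u y \<le> (A * (1 / \<kappa>) ^ \<gamma>) * (r / bdist \<Omega> y) ^ \<gamma>" if y: "y \<in> \<Omega> \<inter> cball x r" for y
    proof -
      have "u y \<le> A * (d / bdist \<Omega> y) ^ \<gamma>"
      proof (rule poly[OF sol q(1) r0(1) r1(2) _ x'O _ _ _ x'(2) _ A g2 g1])
        show "dist q x' < 3 * r" using dist_triangle[of q x' x] q(2) bx2 x'(1) r0 by (simp add: dist_commute)
        show "dist q y < 3 * r" using dist_triangle[of q y x] q(2) bx2 y r0 by (simp add: dist_commute)
        show "bdist \<Omega> y \<le> d" using bdist_lipschitz[of \<Omega> y x] bx2 y r0 by (simp add: dist_commute)
      qed (use y r0 d in auto)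
      also have "d / bdist \<Omega> y = (1 / \<kappa>) * (r / bdist \<Omega> y)" using \<kappa>(1) by (simp add: r_def)
      finally show ?thesis by (simp only: power_mult_distrib mult.assoc)
    qed
    have van': "vanishes_on \<Omega> (frontier \<Omega> \<inter> cball x r) u"
    proof (rule vanishes_on_subset[OF van])
      have "y \<notin> F" if "dist x y \<le> r" for y using infdist_le[of y F x] that r0 d by (auto simp: d_def)
      then show "frontier \<Omega> \<inter> cball x r \<subseteq> frontier \<Omega> - F" by auto
    qed
    have sh: "weakly_subharmonic \<Omega> u" unfolding weakly_subharmonic_def using u(1,3) g_nonneg by blast
    have LA: "u y \<le> L * A" if "y \<in> \<Omega>" "y \<in> ball x (r / 2)" for y
    proof -
      have "u y \<le> K * (A * (1 / \<kappa>) ^ \<gamma>)"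
        using that A \<kappa>(1) a up by (intro carlesonD[OF carleson sh u(3) r0(1) r1(3) x _ van']) (auto simp: a_def)
      then show ?thesis by (simp add: L_def mult_ac)
    qed
    have "u x \<le> 1 / (2 * L * C2) * (L * A)"
    proof (rule boundary_decayD[OF decay sh _ _ x])
      show "vanishes_on \<Omega> (frontier \<Omega> \<inter> ball x (r / 2)) u"
        by (rule vanishes_on_subset[OF van']) (use r0 in auto)
    qed (use LA L A bx r0 r1 in auto)
    then have "a \<le> a / 2" using L C2 by (simp add: A_def a_def)
    then show False using a by simp
  qed
  then show ?thesis using c(1) by blast
qed

end

theorem theoremA8:
  fixes \<Omega> :: "'a::euclidean_space set"
    and g :: "'a \<Rightarrow> real \<Rightarrow> real"
    and C\<^sub>1 C\<^sub>2 \<epsilon>\<^sub>0 :: real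
  assumes "bounded_lipschitz_domain \<Omega>"
    and "continuous_on (\<Omega> \<times> {0..}) (\<lambda>(x, t). g x t)"
    and "\<And>x t. x \<in> \<Omega> \<Longrightarrow> 0 \<le> t \<Longrightarrow> 0 \<le> g x t"
    and "\<And>x. x \<in> \<Omega> \<Longrightarrow> g x 0 = 0"
    and "\<And>x. x \<in> \<Omega> \<Longrightarrow> mono_on {0..} (g x)"
    and "1 \<le> C\<^sub>1"
    and "\<And>x x' a. x \<in> \<Omega> \<Longrightarrow> x' \<in> \<Omega> \<Longrightarrow> dist x' x \<le> bdist \<Omega> x / 2 \<Longrightarrow> 0 \<le> a \<Longrightarrow>
           g x' a \<le> C\<^sub>1 * g x a"
    and "1 \<le> C\<^sub>2" and "0 < \<epsilon>\<^sub>0"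
    and "KOT' \<Omega> g C\<^sub>2"
    and "quasi_inwardly_increasing C\<^sub>2 \<epsilon>\<^sub>0 \<Omega> g"
  shows "\<exists>c\<ge>1. \<forall>F u. closed F \<and> F \<subseteq> frontier \<Omega> \<and>
           nonneg_solution \<Omega> g u \<and> vanishes_on \<Omega> (frontier \<Omega> - F) u \<longrightarrow>
           (\<forall>x\<in>\<Omega>. g x (u x) \<le> c / (infdist x F)\<^sup>2 * u x)"
proof -
  interpret absorption \<Omega> g C\<^sub>1 C\<^sub>2 \<epsilon>\<^sub>0 by (rule absorption.intro) (fact assms)+
  obtain c where c: "1 \<le> c" and est:
    "\<And>F u x. closed F \<Longrightarrow> F \<noteq> {} \<Longrightarrow> F \<subseteq> frontier \<Omega> \<Longrightarrow> nonneg_solution \<Omega> g u \<Longrightarrow>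
     vanishes_on \<Omega> (frontier \<Omega> - F) u \<Longrightarrow> x \<in> \<Omega> \<Longrightarrow> g x (u x) * (infdist x F)\<^sup>2 \<le> c * u x"
    using estimate_nonempty by blast
  have "g x (u x) \<le> c / (infdist x F)\<^sup>2 * u x"
    if F: "closed F" "F \<subseteq> frontier \<Omega>" and sol: "nonneg_solution \<Omega> g u"
      and van: "vanishes_on \<Omega> (frontier \<Omega> - F) u" and x: "x \<in> \<Omega>" for F u x
  proof (cases "F = {}")
    case True
    then have "u x = 0" using zero_if_vanishes_everywhere[OF sol _ x] van by simp
    then show ?thesis using g_zero[OF x] by simp
  next
    case False
    have "x \<notin> F" using F(2) x open_\<Omega> by (auto simp: frontier_def interior_open)
    then have "0 < infdist x F" using F(1) False infdist_pos_not_in_closed by blast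
    then show ?thesis using est[OF F(1) False F(2) sol van x] by (simp add: field_simps)
  qed
  then show ?thesis using c by blast
qed

end
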